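(* Let $k$ be a field and $R=k[x_1,x_2,x_3]/(x_1x_2,x_1x_3)$. Let $P_*$ be the complex of free $R$-modules obtained by applying the Chain Complex Construction Procedure to $R$ with initial map $R\xrightarrow{x_1}R$. Then, for a suitable ordering of the vertices (basis elements) in each degree, $P_*$ is given in degree $n\ge 0$ by $P_n=\bigoplus_{i=1}^{f_{n+1}}R$, where $f_i$ is the $i$-th Fibonacci number ($f_1=f_2=1$), and its differential $d_n:P_n\to P_{n-1}$ is given by $$d_1=\begin{bmatrix}x_1\end{bmatrix},\qquad d_2=\begin{bmatrix}x_2&x_3\end{bmatrix},\qquad d_3=\begin{bmatrix}x_1&x_3&0\\0&-x_2&x_1\end{bmatrix},$$ and, for $n\ge 4$, by the block matrix $$d_n=\begin{bmatrix}d_{n-2}&0&0\\0&d_{n-3}&0\\0&0&d_{n-2}\end{bmatrix}.$$ Moreover $P_*$ is a free resolution of the $R$-module $R/(x_1)$; that is, $\cdots\to P_2\xrightarrow{d_2}P_1\xrightarrow{d_1}P_0\xrightarrow{d_0}R/(x_1)\to 0$ is an exact sequence, where $d_0:P_0=R\to R/(x_1)$ is the canonical projection.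
   Context: **Chain Complex Construction Procedure** for $R=k[x_1,\ldots,x_n]/I$, with $I$ generated by quadratic monomials (here $n=3$ and $I=(x_1x_2,x_1x_3)$). The procedure builds a graded diagram: a set of vertices in each degree $d\ge 0$, together with arrows from vertices of degree $d+1$ to vertices of degree $d$. Each arrow carries a label $i\in\{1,\ldots,n\}$ and a sign $+$ or $-$ (no sign written means $+$). *Initial map.* There is one vertex in degree $0$, one vertex in degree $1$, and one arrow from the latter to the former; here its label is $1$ and its sign is $+$. *Completion.* Given the vertices of degrees $d$ and $d+1$ and the arrows between them ($d\ge 0$), the vertices of degree $d+2$ and the arrows from degree $d+2$ to degree $d+1$ are exactly those produced by the following rules. (a) Column completion: for every arrow $v\to w$ from degree $d+1$ to degree $d$ with label $i$ (of either sign), and every $j\in\{1,\ldots,n\}$ ($j=i$ allowed) with $x_ix_j\in I$, add a new vertex $u$ of degree $d+2$ and an arrow $u\to v$ with label $j$. (b) Diamond completion: for every two arrows $v\to w$ with label $i$ and $v'\to w$ with label $j$ (of either sign) from two different vertices $v,v'$ of degree $d+1$ to the same vertex $w$ of degree $d$, with $i\ne j$ and $x_ix_j\notin I$, add a new vertex $u$ of degree $d+2$ with an arrow $u\to v$ of label $j$ and an arrow $u\to v'$ of label $i$. (c) No repetitions: whenever two or more of the arrows added by (a) and (b) have the same target vertex and the same label, they are merged, i.e. identified into a single arrow (and hence their source vertices are identified as well). *Signs.* When completing a diamond in (b) whose two bottom arrows $v\to w$, $v'\to w$ have sign $+$, the top arrow ($u\to v$ or $u\to v'$) with the smaller label carries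 the minus sign and the other has sign $+$; if one of the bottom arrows already carries a minus sign, that sign is kept and the two top arrows have sign $+$. Arrows arising only from column completions have sign $+$. The completion step is repeated for $d=0,1,2,\ldots$ indefinitely. *From the diagram to modules.* The module in degree $d$ is the free $R$-module with basis the set of vertices of degree $d$ (and $0$ for $d<0$). The differential from degree $d+1$ to degree $d$ is the map whose component from the copy of $R$ at $v$ to the copy of $R$ at $w$ is multiplication by the sum of $\pm x_i$ over all arrows $v\to w$, where $i$ is the label and $\pm$ the sign of the arrow (zero if there is no arrow). *)

theory Defs
  imports
    "HOL-Library.Poly_Mapping"
    "HOL-Number_Theory.Fib"
    "Jordan_Normal_Form.Matrix"
begin

text \<open>
  An ideal of a commutative ring is a submodule of the ring regarded as a module over itself.
  The locale \<open>module\<close> also exists in HOL-Algebra, hence the qualified name \<open>Modules.module\<close>.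
\<close>

lemma module_times: "Modules.module ((*) :: 'a::comm_ring_1 \<Rightarrow> 'a \<Rightarrow> 'a)"
  by (rule Modules.module.intro) (simp_all add: algebra_simps)

definition ideal_gen :: "'a::comm_ring_1 set \<Rightarrow> 'a set" where
  "ideal_gen S = Modules.module.span (*) S"

lemma ideal_gen_zero: "0 \<in> ideal_gen S"
  unfolding ideal_gen_def by (rule Modules.module.span_zero[OF module_times])

lemma ideal_gen_add: "a \<in> ideal_gen S \<Longrightarrow> b \<in> ideal_gen S \<Longrightarrow> a + b \<in> ideal_gen S"
  unfolding ideal_gen_def by (rule Modules.module.span_add[OF module_times])

lemma ideal_gen_neg: "a \<in> ideal_gen S \<Longrightarrow> - a \<in> ideal_gen S"
  unfolding ideal_gen_def by (rule Modules.module.span_neg[OF module_times])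

lemma ideal_gen_mult: "a \<in> ideal_gen S \<Longrightarrow> r * a \<in> ideal_gen S"
  unfolding ideal_gen_def by (rule Modules.module.span_scale[OF module_times])

lemma equivp_ideal_gen: "equivp (\<lambda>a b :: 'a::comm_ring_1. a - b \<in> ideal_gen S)"
proof (rule equivpI)
  show "reflp (\<lambda>a b. a - b \<in> ideal_gen S)"
    by (rule reflpI) (simp add: ideal_gen_zero)
  show "symp (\<lambda>a b. a - b \<in> ideal_gen S)"
    by (rule sympI) (metis ideal_gen_neg minus_diff_eq)
  show "transp (\<lambda>a b. a - b \<in> ideal_gen S)"
  proof (rule transpI)
    fix a b c assume "a - b \<in> ideal_gen S" "b - c \<in> ideal_gen S"
    then have "(a - b) + (b - c) \<in> ideal_gen S" by (rule ideal_gen_add)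
    then show "a - c \<in> ideal_gen S" by simp
  qed
qed

text \<open>Finitely supported functions from exponent vectors to coefficients.\<close>

type_synonym ('x, 'k) mpoly = "('x \<Rightarrow>\<^sub>0 nat) \<Rightarrow>\<^sub>0 'k"

definition pvar :: "'x \<Rightarrow> ('x, 'k::comm_ring_1) mpoly" where
  "pvar i = Poly_Mapping.single (Poly_Mapping.single i 1) 1"

datatype ('v, 'x) arrow = Arrow (src: 'v) (tgt: 'v) (lab: 'x) (neg: bool)

text \<open>
  Each vertex is named after the way in which it was added: \<open>Deg0\<close> and \<open>Deg1\<close> are the two vertices
  of the initial map, \<open>ColV a j\<close> comes from the column completion of the arrow \<open>a\<close> with
  the label \<open>j\<close>, and \<open>DiaV a b\<close> from the diamond completion of the arrows \<open>a\<close> and \<open>b\<close>.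
\<close>

datatype 'x vertex =
    Deg0
  | Deg1
  | ColV "('x vertex, 'x) arrow" 'x
  | DiaV "('x vertex, 'x) arrow" "('x vertex, 'x) arrow"

type_synonym 'x varrow = "('x vertex, 'x) arrow"

text \<open>
  In what follows \<open>I\<close> is the ideal and \<open>A\<close> is the set of arrows from degree \<open>d + 1\<close> to degree \<open>d\<close>.
  An unordered pair of arrows with different labels is listed once, the arrow with the smaller
  label first.
\<close>

definition column_vertices :: "('x, 'k::comm_ring_1) mpoly set \<Rightarrow> 'x varrow set \<Rightarrow> 'x vertex set" where
  "column_vertices I A = {ColV a j | a j. a \<in> A \<and> pvar (lab a) * pvar j \<in> I}"

definition diamond_vertices ::
    "('x::linorder, 'k::comm_ring_1) mpoly set \<Rightarrow> 'x varrow set \<Rightarrow> 'x vertex set" where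
  "diamond_vertices I A = {DiaV a b | a b. a \<in> A \<and> b \<in> A \<and> tgt a = tgt b \<and> src a \<noteq> src b \<and>
     lab a < lab b \<and> pvar (lab a) * pvar (lab b) \<notin> I}"

definition new_vertices ::
    "('x::linorder, 'k::comm_ring_1) mpoly set \<Rightarrow> 'x varrow set \<Rightarrow> 'x vertex set" where
  "new_vertices I A = column_vertices I A \<union> diamond_vertices I A"

text \<open>
  In a diamond, the top arrow ending at the source of \<open>a\<close> has the label of \<open>b\<close> and vice versa.
  Since \<open>lab a < lab b\<close>, the one with the smaller label is the one ending at the source of \<open>b\<close>.
\<close>

fun new_arrows_from :: "'x vertex \<Rightarrow> 'x varrow set" where
  "new_arrows_from (ColV a j) = {Arrow (ColV a j) (src a) j False}"
| "new_arrows_from (DiaV a b) =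
     {Arrow (DiaV a b) (src a) (lab b) False,
      Arrow (DiaV a b) (src b) (lab a) (\<not> neg a \<and> \<not> neg b)}"
| "new_arrows_from _ = {}"

definition new_arrows ::
    "('x::linorder, 'k::comm_ring_1) mpoly set \<Rightarrow> 'x varrow set \<Rightarrow> 'x varrow set" where
  "new_arrows I A = (\<Union>u\<in>new_vertices I A. new_arrows_from u)"

text \<open>
  Merging two arrows identifies their sources. The vertices after merging are the classes of the
  equivalence relation generated by these identifications; a class is represented by an arbitrary
  but fixed member.
\<close>

definition identified ::
    "('x::linorder, 'k::comm_ring_1) mpoly set \<Rightarrow> 'x varrow set \<Rightarrow> ('x vertex \<times> 'x vertex) set" where
  "identified I A = {(src e, src f) | e f.
     e \<in> new_arrows I A \<and> f \<in> new_arrows I A \<and> tgt e = tgt f \<and> lab e = lab f}\<^sup>*"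

definition merged ::
    "('x::linorder, 'k::comm_ring_1) mpoly set \<Rightarrow> 'x varrow set \<Rightarrow> 'x vertex \<Rightarrow> 'x vertex" where
  "merged I A u = (SOME u'. (u, u') \<in> identified I A)"

definition completion_vertices ::
    "('x::linorder, 'k::comm_ring_1) mpoly set \<Rightarrow> 'x varrow set \<Rightarrow> 'x vertex set" where
  "completion_vertices I A = merged I A ` new_vertices I A"

text \<open>
  A merged arrow has a minus sign if one of the arrows merged into it does; in particular
  it has a plus sign if all of them come from column completions.
\<close>

definition completion_arrows ::
    "('x::linorder, 'k::comm_ring_1) mpoly set \<Rightarrow> 'x varrow set \<Rightarrow> 'x varrow set" where
  "completion_arrows I A =
     (\<lambda>e. Arrow (merged I A (src e)) (tgt e) (lab e)
        (\<exists>f\<in>new_arrows I A. tgt f = tgt e \<and> lab f = lab e \<and> neg f)) ` new_arrows I A"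

text \<open>
  \<open>arrows I i n\<close> is the set of arrows from degree \<open>n\<close> to degree \<open>n - 1\<close> and \<open>vertices I i n\<close> is the
  set of vertices of degree \<open>n\<close>, where \<open>i\<close> is the label of the initial arrow.
\<close>

fun arrows :: "('x::linorder, 'k::comm_ring_1) mpoly set \<Rightarrow> 'x \<Rightarrow> nat \<Rightarrow> 'x varrow set" where
  "arrows I i 0 = {}"
| "arrows I i (Suc 0) = {Arrow Deg1 Deg0 i False}"
| "arrows I i (Suc (Suc d)) = completion_arrows I (arrows I i (Suc d))"

fun vertices :: "('x::linorder, 'k::comm_ring_1) mpoly set \<Rightarrow> 'x \<Rightarrow> nat \<Rightarrow> 'x vertex set" where
  "vertices I i 0 = {Deg0}"
| "vertices I i (Suc 0) = {Deg1}"
| "vertices I i (Suc (Suc d)) = completion_vertices I (arrows I i (Suc d))"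

definition free_scale :: "'r::comm_ring_1 \<Rightarrow> ('v \<Rightarrow>\<^sub>0 'r) \<Rightarrow> ('v \<Rightarrow>\<^sub>0 'r)" where
  "free_scale r = Poly_Mapping.map ((*) r)"

definition free_module_on :: "'v set \<Rightarrow> ('v \<Rightarrow>\<^sub>0 'r::comm_ring_1) set" where
  "free_module_on V = {f. Poly_Mapping.keys f \<subseteq> V}"

definition chain_module ::
    "('x::linorder, 'k::comm_ring_1) mpoly set \<Rightarrow> 'x \<Rightarrow> nat \<Rightarrow> ('x vertex \<Rightarrow>\<^sub>0 'r::comm_ring_1) set" where
  "chain_module I i n = free_module_on (vertices I i n)"

text \<open>In the following \<open>\<xi> j\<close> is the element of the coefficient ring by which label \<open>j\<close> acts.\<close>

definition component :: "('x::linorder, 'k::comm_ring_1) mpoly set \<Rightarrow> 'x \<Rightarrow> ('x \<Rightarrow> 'r::comm_ring_1) \<Rightarrow>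
    nat \<Rightarrow> 'x vertex \<Rightarrow> 'x vertex \<Rightarrow> 'r" where
  "component I i \<xi> n v w =
     (\<Sum>a\<in>{a \<in> arrows I i n. src a = v \<and> tgt a = w}. if neg a then - \<xi> (lab a) else \<xi> (lab a))"

definition differential :: "('x::linorder, 'k::comm_ring_1) mpoly set \<Rightarrow> 'x \<Rightarrow> ('x \<Rightarrow> 'r::comm_ring_1) \<Rightarrow>
    nat \<Rightarrow> ('x vertex \<Rightarrow>\<^sub>0 'r) \<Rightarrow> ('x vertex \<Rightarrow>\<^sub>0 'r)" where
  "differential I i \<xi> n p =
     (\<Sum>v\<in>Poly_Mapping.keys p. \<Sum>w\<in>vertices I i (n - 1).
        Poly_Mapping.single w (component I i \<xi> n v w * Poly_Mapping.lookup p v))"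

definition differential_matrix :: "('x::linorder, 'k::comm_ring_1) mpoly set \<Rightarrow> 'x \<Rightarrow>
    ('x \<Rightarrow> 'r::comm_ring_1) \<Rightarrow> (nat \<Rightarrow> nat \<Rightarrow> 'x vertex) \<Rightarrow> nat \<Rightarrow> 'r mat" where
  "differential_matrix I i \<xi> ord n =
     mat (card (vertices I i (n - 1))) (card (vertices I i n))
       (\<lambda>(r, c). Poly_Mapping.lookup
          (differential I i \<xi> n (Poly_Mapping.single (ord n c) 1)) (ord (n - 1) r))"

definition linear_on :: "('r \<Rightarrow> 'p \<Rightarrow> 'p) \<Rightarrow> ('r \<Rightarrow> 'm \<Rightarrow> 'm) \<Rightarrow> 'p set \<Rightarrow>
    ('p::ab_group_add \<Rightarrow> 'm::ab_group_add) \<Rightarrow> bool" where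
  "linear_on sp sm P f \<longleftrightarrow>
     (\<forall>p\<in>P. \<forall>q\<in>P. f (p + q) = f p + f q) \<and> (\<forall>r. \<forall>p\<in>P. f (sp r p) = sm r (f p))"

definition free_submodule :: "('r::comm_ring_1 \<Rightarrow> 'p::ab_group_add \<Rightarrow> 'p) \<Rightarrow> 'p set \<Rightarrow> bool" where
  "free_submodule s P \<longleftrightarrow>
     (\<exists>B. \<not> Modules.module.dependent s B \<and> Modules.module.span s B = P)"

text \<open>
  The modules of the complex are submodules \<open>P n\<close> of one ambient module with scalar
  multiplication \<open>sp\<close>; the resolved module is the type \<open>'m\<close> with scalar multiplication \<open>sm\<close>.
\<close>

definition free_resolution :: "('r::comm_ring_1 \<Rightarrow> 'p::ab_group_add \<Rightarrow> 'p) \<Rightarrow> (nat \<Rightarrow> 'p set) \<Rightarrow>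
    (nat \<Rightarrow> 'p \<Rightarrow> 'p) \<Rightarrow> ('r \<Rightarrow> 'm::ab_group_add \<Rightarrow> 'm) \<Rightarrow> ('p \<Rightarrow> 'm) \<Rightarrow> bool" where
  "free_resolution sp P d sm \<epsilon> \<longleftrightarrow>
     Modules.module sp \<and> Modules.module sm \<and>
     (\<forall>n. free_submodule sp (P n)) \<and>
     (\<forall>n\<ge>1. linear_on sp sp (P n) (d n) \<and> d n ` P n \<subseteq> P (n - 1)) \<and>
     linear_on sp sm (P 0) \<epsilon> \<and>
     \<epsilon> ` P 0 = UNIV \<and>
     {p \<in> P 0. \<epsilon> p = 0} = d 1 ` P 1 \<and>
     (\<forall>n\<ge>1. {p \<in> P n. d n p = 0} = d (n + 1) ` P (n + 1))"

datatype idx = X1 | X2 | X3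

instantiation idx :: linorder
begin

fun idx_nat :: "idx \<Rightarrow> nat" where
  "idx_nat X1 = 1"
| "idx_nat X2 = 2"
| "idx_nat X3 = 3"

definition less_eq_idx :: "idx \<Rightarrow> idx \<Rightarrow> bool" where
  "i \<le> j \<longleftrightarrow> idx_nat i \<le> idx_nat j"

definition less_idx :: "idx \<Rightarrow> idx \<Rightarrow> bool" where
  "i < j \<longleftrightarrow> idx_nat i < idx_nat j"

instance
proof
  fix i j :: idx
  show "i \<le> j \<Longrightarrow> j \<le> i \<Longrightarrow> i = j"
    by (cases i; cases j) (simp_all add: less_eq_idx_def)
qed (auto simp: less_eq_idx_def less_idx_def)

end

definition I_rel :: "(idx, 'k::field) mpoly set" where
  "I_rel = ideal_gen {pvar X1 * pvar X2, pvar X1 * pvar X3}"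

lemma one_notin_I_rel: "(1 :: (idx, 'k::field) mpoly) \<notin> I_rel"
proof
  have const: "Poly_Mapping.lookup (r * pvar i) 0 = 0" for r :: "(idx, 'k) mpoly" and i
  proof -
    have *: "(0::idx \<Rightarrow>\<^sub>0 nat) \<noteq> l + Poly_Mapping.single i 1" for l
      by (metis add_is_0 lookup_add lookup_single_eq lookup_zero one_neq_zero)
    have "(Poly_Mapping.lookup (pvar i) q when 0 = l + q) = (0::'k)" for l q
      using *[of l] by (auto simp: pvar_def lookup_single when_def)
    then show ?thesis
      unfolding times_poly_mapping.rep_eq prod_fun_def by simp
  qed
  have vanish: "p \<in> I_rel \<Longrightarrow> Poly_Mapping.lookup p 0 = 0" for p :: "(idx, 'k) mpoly"
    unfolding I_rel_def ideal_gen_def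
  proof (induction p
      rule: Modules.module.span_induct_alt[OF module_times, consumes 1, case_names base step])
    case base
    then show ?case by simp
  next
    case (step c x y)
    then obtain i r where "x = r * pvar i" by auto
    then have "Poly_Mapping.lookup (c * x) 0 = 0"
      using const[of "c * r" i] by (simp add: mult.assoc)
    with step show ?case by (simp add: lookup_add)
  qed
  assume "(1 :: (idx, 'k) mpoly) \<in> I_rel"
  then show False using vanish[of 1] by simp
qed

quotient_type (overloaded) 'k qring = "(idx, 'k::field) mpoly" / "\<lambda>p q. p - q \<in> I_rel"
  unfolding I_rel_def by (rule equivp_ideal_gen)

instantiation qring :: (field) comm_ring_1
begin

lift_definition zero_qring :: "'a qring" is 0 .
lift_definition one_qring :: "'a qring" is 1 .

lift_definition plus_qring :: "'a qring \<Rightarrow> 'a qring \<Rightarrow> 'a qring" is "(+)"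
  unfolding I_rel_def by (metis add_diff_add ideal_gen_add)

lift_definition uminus_qring :: "'a qring \<Rightarrow> 'a qring" is uminus
  unfolding I_rel_def by (metis ideal_gen_neg minus_diff_minus)

lift_definition minus_qring :: "'a qring \<Rightarrow> 'a qring \<Rightarrow> 'a qring" is "(-)"
proof -
  fix a a' b b' :: "(idx, 'a) mpoly"
  assume "a - a' \<in> I_rel" "b - b' \<in> I_rel"
  then have "(a - a') + - (b - b') \<in> I_rel"
    unfolding I_rel_def by (intro ideal_gen_add ideal_gen_neg)
  then show "(a - b) - (a' - b') \<in> I_rel" by (simp add: algebra_simps)
qed

lift_definition times_qring :: "'a qring \<Rightarrow> 'a qring \<Rightarrow> 'a qring" is "(*)"
proof -
  fix a a' b b' :: "(idx, 'a) mpoly"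
  assume "a - a' \<in> I_rel" "b - b' \<in> I_rel"
  then have "b * (a - a') + a' * (b - b') \<in> I_rel"
    unfolding I_rel_def by (intro ideal_gen_add ideal_gen_mult)
  then show "a * b - a' * b' \<in> I_rel" by (simp add: algebra_simps)
qed

instance
proof
  show "(0::'a qring) \<noteq> 1"
    by transfer (metis diff_0 I_rel_def ideal_gen_neg minus_minus one_notin_I_rel)
qed (transfer; simp add: I_rel_def ideal_gen_zero algebra_simps)+

end

definition xvar :: "idx \<Rightarrow> 'k::field qring" where
  "xvar i = abs_qring (pvar i)"

quotient_type (overloaded) 'k cyc = "'k::field qring" / "\<lambda>a b. a - b \<in> ideal_gen {xvar X1}"
  by (rule equivp_ideal_gen)

instantiation cyc :: (field) ab_group_add
begin

lift_definition zero_cyc :: "'a cyc" is 0 .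

lift_definition plus_cyc :: "'a cyc \<Rightarrow> 'a cyc \<Rightarrow> 'a cyc" is "(+)"
  by (metis add_diff_add ideal_gen_add)

lift_definition uminus_cyc :: "'a cyc \<Rightarrow> 'a cyc" is uminus
  by (metis ideal_gen_neg minus_diff_minus)

lift_definition minus_cyc :: "'a cyc \<Rightarrow> 'a cyc \<Rightarrow> 'a cyc" is "(-)"
proof -
  fix a a' b b' :: "'a qring"
  assume "a - a' \<in> ideal_gen {xvar X1}" "b - b' \<in> ideal_gen {xvar X1}"
  then have "(a - a') + - (b - b') \<in> ideal_gen {xvar X1}"
    by (intro ideal_gen_add ideal_gen_neg)
  then show "(a - b) - (a' - b') \<in> ideal_gen {xvar X1}" by (simp add: algebra_simps)
qed

instance
  by standard (transfer; simp add: ideal_gen_zero algebra_simps)+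

end

definition cyc_scale :: "'k::field qring \<Rightarrow> 'k cyc \<Rightarrow> 'k cyc" where
  "cyc_scale r m = abs_cyc (r * rep_cyc m)"

lemma cyc_scale_abs_cyc: "cyc_scale r (abs_cyc a) = abs_cyc (r * a)"
proof -
  have "rep_cyc (abs_cyc a) - a \<in> ideal_gen {xvar X1}"
    by (rule Quotient_rep_abs[OF Quotient_cyc]) (simp add: ideal_gen_zero)
  then have "r * rep_cyc (abs_cyc a) - r * a \<in> ideal_gen {xvar X1}"
    by (metis ideal_gen_mult right_diff_distrib)
  then show ?thesis
    unfolding cyc_scale_def by (simp add: cyc.abs_eq_iff)
qed

text \<open>
  The complex has only the vertex \<open>Deg0\<close> in degree 0, so its module in degree 0 is the ring itself
  via the coordinate at \<open>Deg0\<close>; \<open>abs_cyc\<close> is the canonical projection.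
\<close>

definition augmentation :: "(idx vertex \<Rightarrow>\<^sub>0 'k::field qring) \<Rightarrow> 'k cyc" where
  "augmentation p = abs_cyc (Poly_Mapping.lookup p Deg0)"

end

theory Submission
  imports Defs
begin

text \<open>
  Write \<open>R = k[x1,x2,x3]/(x1x2, x1x3)\<close>. The arrows between two consecutive degrees of the diagram
  always fall apart into disjoint copies of three small pieces: an edge (one arrow with label 1),
  a fork (arrows with labels 2 and 3 from two vertices to a common target) and a zigzag
  (three sources, two targets, labels 1, 3, -2, 1). These are the diagrams of the three
  matrices \<open>d1\<close>, \<open>d2\<close>, \<open>d3\<close>. The completion rules only look at arrows with a common
  target and only attach new arrows to the sources of old ones, so completion acts piecewise:
  it turns an edge into a fork, a fork into a zigzag, and a zigzag into a fork, an edge and a fork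
  (lemma \<open>completion_pieces\<close>). The edge in the last case is the only place where two arrows get merged.

  So the sequence of pieces in each degree is an iterate of a substitution on words in three
  letters. Starting from a single edge, three steps give fork, edge, fork, which is the second
  word, the first word, and the second word again; since a substitution respects concatenation,
  every later word is composed in the same way from the earlier ones (\<open>block_sizes_rec\<close>).
  If the vertices are ordered piece by piece, the matrix of the differential is block diagonal
  with one block per piece (\<open>differential_matrix_eq\<close>), and this gives both the Fibonacci
  numbers and the recursion for the matrices.

  Exactness is a piecewise statement as well: the kernel of a piece has to be the image of the
  pieces that completion attaches to it. For the three pieces this follows from a few facts
  about \<open>R\<close>: the annihilator of \<open>x1\<close> is \<open>(x2, x3)\<close>; that of \<open>x3\<close> is \<open>(x1)\<close>; the relations
  between \<open>x2\<close> and \<open>x3\<close> are generated by \<open>(x1, 0)\<close>, \<open>(x3, -x2)\<close> and \<open>(0, x1)\<close>; and \<open>(x1)\<close> meets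
  \<open>(x2)\<close> and \<open>(x3)\<close> trivially. They hold because the ideal is generated by monomials, so that
  membership in it can be read off from single coefficients (\<open>in_I_rel_iff\<close>).
\<close>

section \<open>Divisibility by variables and the monomial ideal\<close>

abbreviation mono1 :: "'x \<Rightarrow> 'x \<Rightarrow>\<^sub>0 nat" where
  "mono1 i \<equiv> Poly_Mapping.single i (Suc 0)"

lemma lookup_pvar_mult_shift:
  fixes p :: "('x, 'k::comm_ring_1) mpoly"
  shows "Poly_Mapping.lookup (pvar i * p) (m + mono1 i) = Poly_Mapping.lookup p m"
proof -
  have "Poly_Mapping.lookup (pvar i * p) (m + mono1 i)
     = (\<Sum>l. (\<Sum>q. Poly_Mapping.lookup p q when m + mono1 i = l + q) when l = mono1 i)"
    unfolding lookup_mult pvar_def One_nat_def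
    by (intro Sum_any.cong) (auto simp: lookup_single when_def)
  also have "\<dots> = (\<Sum>q. Poly_Mapping.lookup p q when q = m)"
    by (auto simp: add.commute[of m] intro!: Sum_any.cong simp: when_def)
  finally show ?thesis by simp
qed

lemma lookup_pvar_mult_zero:
  fixes p :: "('x, 'k::comm_ring_1) mpoly"
  assumes "Poly_Mapping.lookup m i = 0"
  shows "Poly_Mapping.lookup (pvar i * p) m = 0"
proof -
  have "m \<noteq> mono1 i + q" for q
    using assms by (auto simp: lookup_add)
  then have *: "(\<Sum>q. Poly_Mapping.lookup p q when m = mono1 i + q) = 0"
    by (simp only: simp_thms when_simps Sum_any.neutral)
  have "Poly_Mapping.lookup (pvar i :: ('x, 'k) mpoly) l * (\<Sum>q. Poly_Mapping.lookup p q when m = l + q) = 0" for l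
  proof (cases "l = mono1 i")
    case True
    show ?thesis unfolding True * by (rule mult_zero_right)
  next
    case False
    then show ?thesis by (simp add: pvar_def lookup_single)
  qed
  then show ?thesis
    unfolding lookup_mult by (simp only: Sum_any.neutral)
qed

text \<open>
  The quotient of a polynomial on division by a variable: monomials without that variable are
  dropped.
\<close>

definition var_quot :: "'x \<Rightarrow> ('x, 'k::comm_ring_1) mpoly \<Rightarrow> ('x, 'k) mpoly" where
  "var_quot i p = Poly_Mapping.map_key (\<lambda>m. m + mono1 i) p"

lemma lookup_var_quot: "Poly_Mapping.lookup (var_quot i p) m = Poly_Mapping.lookup p (m + mono1 i)"
  unfolding var_quot_def by (subst map_key.rep_eq) (auto simp: inj_on_def)

lemma monomial_split:
  assumes "Poly_Mapping.lookup m i \<noteq> 0"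
  obtains m' where "m = m' + mono1 i"
proof
  show "m = (m - mono1 i) + mono1 i"
    using assms by (intro poly_mapping_eqI) (auto simp: lookup_add lookup_minus lookup_single when_def)
qed

lemma lookup_pvar_mult_var_quot:
  "Poly_Mapping.lookup (pvar i * var_quot i p) m
     = (if Poly_Mapping.lookup m i = 0 then 0 else Poly_Mapping.lookup p m)"
  by (metis lookup_pvar_mult_shift lookup_pvar_mult_zero lookup_var_quot monomial_split)

lemma pvar_dvdI:
  assumes "\<And>m. Poly_Mapping.lookup m i = 0 \<Longrightarrow> Poly_Mapping.lookup p m = 0"
  shows "p = pvar i * var_quot i p"
  by (rule poly_mapping_eqI) (simp add: lookup_pvar_mult_var_quot assms)

lemma pvar2_dvdI:
  fixes p :: "('x, 'k::comm_ring_1) mpoly"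
  assumes "\<And>m. Poly_Mapping.lookup m i = 0 \<Longrightarrow> Poly_Mapping.lookup m j = 0 \<Longrightarrow> Poly_Mapping.lookup p m = 0"
  shows "\<exists>s t. p = pvar i * s + pvar j * t"
proof -
  have "p - pvar i * var_quot i p = pvar j * var_quot j (p - pvar i * var_quot i p)"
    by (rule pvar_dvdI) (auto simp: lookup_minus lookup_pvar_mult_var_quot assms)
  then show ?thesis by (metis add.commute diff_add_cancel)
qed

lemma in_ideal_gen_single: "p \<in> ideal_gen {a} \<longleftrightarrow> (\<exists>f. p = f * a)"
  unfolding ideal_gen_def Modules.module.span_singleton[OF module_times] by auto

lemma in_ideal_gen_pair: "p \<in> ideal_gen {a, b} \<longleftrightarrow> (\<exists>f g. p = f * a + g * b)"
  unfolding ideal_gen_def Modules.module.span_insert[OF module_times] Modules.module.span_singleton[OF module_times]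
    Modules.module.span_empty[OF module_times]
  by (auto simp: algebra_simps)

text \<open>
  The monomials outside the ideal; they are a basis of the quotient ring over the field.
\<close>

definition standard :: "(idx \<Rightarrow>\<^sub>0 nat) \<Rightarrow> bool" where
  "standard m \<longleftrightarrow> Poly_Mapping.lookup m X1 = 0 \<or>
     Poly_Mapping.lookup m X2 = 0 \<and> Poly_Mapping.lookup m X3 = 0"

text \<open>
  A multiple of a generator has no standard monomials. Conversely, a polynomial without standard
  monomials is divisible by \<open>x1\<close>, and every monomial of the quotient involves \<open>x2\<close> or \<open>x3\<close>.
\<close>

lemma in_I_rel_iff:
  "p \<in> I_rel \<longleftrightarrow> (\<forall>m. standard m \<longrightarrow> Poly_Mapping.lookup p m = 0)"
proof
  assume "p \<in> I_rel"
  then obtain f g where p: "p = f * (pvar X1 * pvar X2) + g * (pvar X1 * pvar X3)"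
    unfolding I_rel_def in_ideal_gen_pair by blast
  have 1: "p = pvar X1 * (pvar X2 * f + pvar X3 * g)"
    and 2: "p = pvar X2 * (pvar X1 * f) + pvar X3 * (pvar X1 * g)"
    unfolding p by (simp_all add: algebra_simps)
  have 3: "Poly_Mapping.lookup p m = 0" if "Poly_Mapping.lookup m X1 = 0" for m
    using lookup_pvar_mult_zero[OF that] 1 by metis
  have 4: "Poly_Mapping.lookup p m = 0"
    if "Poly_Mapping.lookup m X2 = 0" "Poly_Mapping.lookup m X3 = 0" for m
    unfolding 2 using that by (simp add: lookup_add lookup_pvar_mult_zero)
  show "\<forall>m. standard m \<longrightarrow> Poly_Mapping.lookup p m = 0"
    using 3 4 unfolding standard_def by blast
next
  assume *: "\<forall>m. standard m \<longrightarrow> Poly_Mapping.lookup p m = 0"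
  have "Poly_Mapping.lookup (var_quot X1 p) m = 0"
    if "Poly_Mapping.lookup m X2 = 0" "Poly_Mapping.lookup m X3 = 0" for m
    using * that by (simp add: lookup_var_quot standard_def lookup_add lookup_single)
  from pvar2_dvdI[OF this] obtain s t where st: "var_quot X1 p = pvar X2 * s + pvar X3 * t"
    by blast
  have "p = pvar X1 * var_quot X1 p"
    by (rule pvar_dvdI) (use * in \<open>auto simp: standard_def\<close>)
  then have "p = s * (pvar X1 * pvar X2) + t * (pvar X1 * pvar X3)"
    unfolding st by (simp add: algebra_simps)
  then show "p \<in> I_rel" unfolding I_rel_def in_ideal_gen_pair by blast
qed

lemma zero_in_I_rel: "0 \<in> I_rel"
  by (simp add: in_I_rel_iff)

lemma pvar_mult_in_I_rel_iff:
  "(pvar i * pvar j :: (idx, 'k::field) mpoly) \<in> I_rel \<longleftrightarrow> (i = X1) \<noteq> (j = X1)"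
proof
  assume *: "(pvar i * pvar j :: (idx, 'k) mpoly) \<in> I_rel"
  have "Poly_Mapping.lookup (pvar i * pvar j :: (idx, 'k) mpoly) (mono1 j + mono1 i) = 1"
    by (subst lookup_pvar_mult_shift) (simp add: pvar_def)
  with * have "\<not> standard (mono1 j + mono1 i)" 
    unfolding in_I_rel_iff by (metis one_neq_zero)
  then show "(i = X1) \<noteq> (j = X1)"
    by (cases i; cases j) (auto simp: standard_def lookup_add lookup_single)
next
  assume *: "(i = X1) \<noteq> (j = X1)"
  have "pvar X1 * pvar X2 \<in> (I_rel :: (idx, 'k) mpoly set)" "pvar X1 * pvar X3 \<in> (I_rel :: (idx, 'k) mpoly set)"
    unfolding I_rel_def in_ideal_gen_pair
    by (rule exI[of _ 1], rule exI[of _ 0], simp) (rule exI[of _ 0], rule exI[of _ 1], simp)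
  then show "(pvar i * pvar j :: (idx, 'k) mpoly) \<in> I_rel"
    using * by (cases i; cases j) (auto simp: mult.commute)
qed

lemma xvar_mult_zero:
  "xvar X1 * xvar X2 = (0 :: 'k::field qring)" "xvar X1 * xvar X3 = (0 :: 'k::field qring)"
  unfolding xvar_def zero_qring_def times_qring.abs_eq qring.abs_eq_iff
  by (simp_all add: pvar_mult_in_I_rel_iff)

lemma annihilator_x1:
  fixes r :: "'k::field qring"
  assumes "xvar X1 * r = 0"
  shows "\<exists>s t. r = xvar X2 * s + xvar X3 * t"
  using assms unfolding xvar_def
proof (transfer)
  fix r :: "(idx, 'k) mpoly"
  assume "pvar X1 * r - 0 \<in> I_rel"
  then have "Poly_Mapping.lookup (pvar X1 * r) (m + mono1 X1) = 0"
    if "Poly_Mapping.lookup m X2 = 0" "Poly_Mapping.lookup m X3 = 0" for m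
    using that by (simp add: in_I_rel_iff standard_def lookup_add lookup_single)
  then have "\<exists>s t. r = pvar X2 * s + pvar X3 * t"
    by (intro pvar2_dvdI) (simp add: lookup_pvar_mult_shift)
  then show "\<exists>s t. r - (pvar X2 * s + pvar X3 * t) \<in> I_rel"
    by (metis diff_self zero_in_I_rel)
qed

lemma annihilator_x3:
  fixes r :: "'k::field qring"
  assumes "xvar X3 * r = 0"
  shows "\<exists>s. r = xvar X1 * s"
  using assms unfolding xvar_def
proof transfer
  fix r :: "(idx, 'k) mpoly"
  assume "pvar X3 * r - 0 \<in> I_rel"
  then have "Poly_Mapping.lookup (pvar X3 * r) (m + mono1 X3) = 0"
    if "Poly_Mapping.lookup m X1 = 0" for m
    using that by (simp add: in_I_rel_iff standard_def lookup_add lookup_single)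
  then have "r = pvar X1 * var_quot X1 r"
    by (intro pvar_dvdI) (simp add: lookup_pvar_mult_shift)
  then show "\<exists>s. r - pvar X1 * s \<in> I_rel"
    by (metis diff_self zero_in_I_rel)
qed

text \<open>
  Reading off the coefficients at monomials free of \<open>x1\<close> and \<open>x3\<close> shows that \<open>r\<close> lies in
  \<open>(x1, x3)\<close>, say \<open>r = x1 p + x3 q\<close>. Substituting this, the relation becomes \<open>x3 (x2 q + s) = 0\<close>,
  and only the multiples of \<open>x1\<close> annihilate \<open>x3\<close>.
\<close>

lemma syzygy_x2_x3:
  fixes r s :: "'k::field qring"
  assumes "xvar X2 * r + xvar X3 * s = 0"
  shows "\<exists>p q t. r = xvar X1 * p + xvar X3 * q \<and> s = xvar X1 * t - xvar X2 * q"
proof -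
  have "\<exists>p q. r = xvar X1 * p + xvar X3 * q"
    using assms unfolding xvar_def
  proof transfer
    fix r s :: "(idx, 'k) mpoly"
    assume *: "pvar X2 * r + pvar X3 * s - 0 \<in> I_rel"
    have "\<exists>p q. r = pvar X1 * p + pvar X3 * q"
    proof (rule pvar2_dvdI)
      fix m :: "idx \<Rightarrow>\<^sub>0 nat"
      assume m: "Poly_Mapping.lookup m X1 = 0" "Poly_Mapping.lookup m X3 = 0"
      then have "Poly_Mapping.lookup (pvar X2 * r + pvar X3 * s) (m + mono1 X2) = 0"
        using * by (simp add: in_I_rel_iff standard_def lookup_add lookup_single)
      moreover have "Poly_Mapping.lookup (pvar X3 * s) (m + mono1 X2) = 0"
        by (rule lookup_pvar_mult_zero) (use m in \<open>simp add: lookup_add lookup_single\<close>)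
      ultimately show "Poly_Mapping.lookup r m = 0"
        by (simp add: lookup_add[of "pvar X2 * r"] lookup_pvar_mult_shift)
    qed
    then show "\<exists>p q. r - (pvar X1 * p + pvar X3 * q) \<in> I_rel"
      by (metis diff_self zero_in_I_rel)
  qed
  then obtain p q where r: "r = xvar X1 * p + xvar X3 * q" by blast
  have "xvar X3 * (xvar X2 * q + s) = (xvar X2 * r + xvar X3 * s) - (xvar X1 * xvar X2) * p"
    unfolding r by (simp add: algebra_simps)
  also have "\<dots> = 0" using assms by (simp add: xvar_mult_zero)
  finally obtain t where "xvar X2 * q + s = xvar X1 * t" using annihilator_x3 by blast
  then have "s = xvar X1 * t - xvar X2 * q" by (simp add: algebra_simps)
  with r show ?thesis by blast
qed

text \<open>
  A standard monomial that involves \<open>x1\<close> is a power of \<open>x1\<close>, hence cannot occur in a multiple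
  of \<open>x2\<close> or \<open>x3\<close>.
\<close>

lemma x1_multiples_meet_trivially:
  fixes p q :: "'k::field qring"
  assumes "xvar X1 * p + xvar j * q = 0" "j \<noteq> X1"
  shows "xvar X1 * p = 0 \<and> xvar j * q = 0"
proof -
  have "xvar X1 * p = 0"
    using assms(1) unfolding xvar_def
  proof (transfer fixing: j)
    fix p q :: "(idx, 'k) mpoly"
    assume *: "pvar X1 * p + pvar j * q - 0 \<in> I_rel"
    have "Poly_Mapping.lookup (pvar X1 * p) m = 0" if "standard m" for m
    proof (cases "Poly_Mapping.lookup m X1 = 0")
      case False
      with that assms(2) have "Poly_Mapping.lookup (pvar j * q) m = 0"
        by (cases j) (auto simp: standard_def intro: lookup_pvar_mult_zero)
      with * that show ?thesis by (auto simp: in_I_rel_iff lookup_add)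
    qed (simp add: lookup_pvar_mult_zero)
    then show "pvar X1 * p - 0 \<in> I_rel" by (auto simp: in_I_rel_iff)
  qed
  with assms(1) show ?thesis by simp
qed

section \<open>Pieces of the diagram and their completion\<close>

text \<open>
  Sources are listed first, then targets, both in the order of the columns and rows of the
  corresponding matrix.
\<close>

datatype piece =
    Edge "idx vertex" "idx vertex"
  | Fork "idx vertex" "idx vertex" "idx vertex"
  | Zigzag "idx vertex" "idx vertex" "idx vertex" "idx vertex" "idx vertex"

fun sources :: "piece \<Rightarrow> idx vertex list" where
  "sources (Edge v w) = [v]"
| "sources (Fork u u' v) = [u, u']"
| "sources (Zigzag c m c' u u') = [c, m, c']"

fun targets :: "piece \<Rightarrow> idx vertex list" where
  "targets (Edge v w) = [w]"
| "targets (Fork u u' v) = [v]"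
| "targets (Zigzag c m c' u u') = [u, u']"

fun piece_arrows :: "piece \<Rightarrow> idx varrow set" where
  "piece_arrows (Edge v w) = {Arrow v w X1 False}"
| "piece_arrows (Fork u u' v) = {Arrow u v X2 False, Arrow u' v X3 False}"
| "piece_arrows (Zigzag c m c' u u') =
     {Arrow c u X1 False, Arrow m u X3 False, Arrow m u' X2 True, Arrow c' u' X1 False}"

text \<open>
  The parameter \<open>\<mu>\<close> chooses the representative of a merged vertex. The middle vertex of a
  zigzag acquires two column vertices, one for each of its two arrows; they are identified, so
  naming the one over the arrow with label 3 is enough.
\<close>

fun next_pieces :: "(idx vertex \<Rightarrow> idx vertex) \<Rightarrow> piece \<Rightarrow> piece list" where
  "next_pieces \<mu> (Edge v w) =
     [Fork (\<mu> (ColV (Arrow v w X1 False) X2)) (\<mu> (ColV (Arrow v w X1 False) X3)) v]"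
| "next_pieces \<mu> (Fork u u' v) =
     [Zigzag (\<mu> (ColV (Arrow u v X2 False) X1))
        (\<mu> (DiaV (Arrow u v X2 False) (Arrow u' v X3 False)))
        (\<mu> (ColV (Arrow u' v X3 False) X1)) u u']"
| "next_pieces \<mu> (Zigzag c m c' u u') =
     [Fork (\<mu> (ColV (Arrow c u X1 False) X2)) (\<mu> (ColV (Arrow c u X1 False) X3)) c,
      Edge (\<mu> (ColV (Arrow m u X3 False) X1)) m,
      Fork (\<mu> (ColV (Arrow c' u' X1 False) X2)) (\<mu> (ColV (Arrow c' u' X1 False) X3)) c']"

definition separated :: "piece list \<Rightarrow> bool" where
  "separated ps \<longleftrightarrow> distinct (concat (map sources ps)) \<and> distinct (concat (map targets ps))"

lemma distinct_concat_map_unique: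
  assumes "distinct (concat (map g xs))" "x \<in> set xs" "y \<in> set xs" "z \<in> set (g x)" "z \<in> set (g y)"
  shows "x = y"
  using assms by (induction xs) auto

lemma distinct_concat_map_member:
  "distinct (concat (map g xs)) \<Longrightarrow> x \<in> set xs \<Longrightarrow> distinct (g x)"
  by (induction xs) auto

lemma separated_sources_unique:
  "separated ps \<Longrightarrow> p \<in> set ps \<Longrightarrow> q \<in> set ps \<Longrightarrow> v \<in> set (sources p) \<Longrightarrow> v \<in> set (sources q) \<Longrightarrow> p = q"
  unfolding separated_def by (blast intro: distinct_concat_map_unique)

lemma separated_targets_unique:
  "separated ps \<Longrightarrow> p \<in> set ps \<Longrightarrow> q \<in> set ps \<Longrightarrow> v \<in> set (targets p) \<Longrightarrow> v \<in> set (targets q) \<Longrightarrow> p = q"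
  unfolding separated_def by (blast intro: distinct_concat_map_unique)

lemma separated_distinct:
  "separated ps \<Longrightarrow> p \<in> set ps \<Longrightarrow> distinct (sources p) \<and> distinct (targets p)"
  unfolding separated_def by (blast intro: distinct_concat_map_member)

lemma src_piece_arrows: "src ` piece_arrows p = set (sources p)"
  by (cases p) auto

lemma tgt_in_targets: "a \<in> piece_arrows p \<Longrightarrow> tgt a \<in> set (targets p)"
  by (cases p) auto

lemma concat_targets_next_pieces: "concat (map targets (next_pieces \<mu> p)) = sources p"
  by (cases p) auto

lemma idx_neq_X1: "{j. j \<noteq> X1} = {X2, X3}"
  by (auto, case_tac x, auto)

lemma column_vertices_I_rel:
  "column_vertices (I_rel :: (idx, 'k::field) mpoly set) A =
     (\<Union>a\<in>A. ColV a ` (if lab a = X1 then {X2, X3} else {X1}))"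
  unfolding column_vertices_def pvar_mult_in_I_rel_iff idx_neq_X1[symmetric] by (auto split: if_splits)

lemma diamond_vertices_I_rel:
  "diamond_vertices (I_rel :: (idx, 'k::field) mpoly set) A =
     {DiaV a b | a b. a \<in> A \<and> b \<in> A \<and> tgt a = tgt b \<and> src a \<noteq> src b \<and> lab a = X2 \<and> lab b = X3}"
proof -
  have "i < j \<and> pvar i * pvar j \<notin> (I_rel :: (idx, 'k) mpoly set) \<longleftrightarrow> i = X2 \<and> j = X3" for i j
    unfolding pvar_mult_in_I_rel_iff by (cases i; cases j) (auto simp: less_idx_def)
  then show ?thesis unfolding diamond_vertices_def by simp
qed

text \<open>
  A diamond needs two arrows with the same target, and these lie in the same piece.
\<close>

lemma new_vertices_I_rel_union:
  assumes "separated ps"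
  shows "new_vertices (I_rel :: (idx, 'k::field) mpoly set) (\<Union>p\<in>set ps. piece_arrows p) =
    (\<Union>p\<in>set ps. new_vertices (I_rel :: (idx, 'k) mpoly set) (piece_arrows p))"
proof -
  have "p = q" if "p \<in> set ps" "q \<in> set ps" "a \<in> piece_arrows p" "b \<in> piece_arrows q" "tgt a = tgt b"
    for p q a b
  proof (rule separated_targets_unique[OF assms that(1,2)])
    show "tgt a \<in> set (targets p)" by (rule tgt_in_targets[OF that(3)])
    show "tgt a \<in> set (targets q)" using tgt_in_targets[OF that(4)] that(5) by simp
  qed
  then have pairs: "(\<exists>p\<in>set ps. a \<in> piece_arrows p) \<and> (\<exists>q\<in>set ps. b \<in> piece_arrows q) \<and> tgt a = tgt b \<longleftrightarrow>
      (\<exists>p\<in>set ps. a \<in> piece_arrows p \<and> b \<in> piece_arrows p) \<and> tgt a = tgt b" for a b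
    by blast
  have "diamond_vertices (I_rel :: (idx, 'k) mpoly set) (\<Union>p\<in>set ps. piece_arrows p) =
      {DiaV a b | a b. ((\<exists>p\<in>set ps. a \<in> piece_arrows p) \<and> (\<exists>q\<in>set ps. b \<in> piece_arrows q) \<and> tgt a = tgt b) \<and>
        src a \<noteq> src b \<and> lab a = X2 \<and> lab b = X3}"
    unfolding diamond_vertices_I_rel by simp
  also have "\<dots> = (\<Union>p\<in>set ps. diamond_vertices (I_rel :: (idx, 'k) mpoly set) (piece_arrows p))"
    unfolding pairs diamond_vertices_I_rel by blast
  finally have "diamond_vertices (I_rel :: (idx, 'k) mpoly set) (\<Union>p\<in>set ps. piece_arrows p) =
      (\<Union>p\<in>set ps. diamond_vertices (I_rel :: (idx, 'k) mpoly set) (piece_arrows p))" .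
  moreover have "column_vertices (I_rel :: (idx, 'k) mpoly set) (\<Union>p\<in>set ps. piece_arrows p) =
      (\<Union>p\<in>set ps. column_vertices (I_rel :: (idx, 'k) mpoly set) (piece_arrows p))"
    unfolding column_vertices_I_rel by simp
  ultimately show ?thesis
    unfolding new_vertices_def by (simp add: UN_Un_distrib)
qed

lemma new_arrows_I_rel_union:
  assumes "separated ps"
  shows "new_arrows (I_rel :: (idx, 'k::field) mpoly set) (\<Union>p\<in>set ps. piece_arrows p) =
    (\<Union>p\<in>set ps. new_arrows (I_rel :: (idx, 'k) mpoly set) (piece_arrows p))"
  unfolding new_arrows_def new_vertices_I_rel_union[OF assms] by auto

fun new_piece_arrows :: "piece \<Rightarrow> idx varrow set" where
  "new_piece_arrows (Edge v w) = (let a = Arrow v w X1 False in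
     {Arrow (ColV a X2) v X2 False, Arrow (ColV a X3) v X3 False})"
| "new_piece_arrows (Fork u u' v) = (let a = Arrow u v X2 False; b = Arrow u' v X3 False in
     {Arrow (ColV a X1) u X1 False, Arrow (DiaV a b) u X3 False,
      Arrow (DiaV a b) u' X2 True, Arrow (ColV b X1) u' X1 False})"
| "new_piece_arrows (Zigzag c m c' u u') =
     (let a = Arrow c u X1 False; b = Arrow m u X3 False; b' = Arrow m u' X2 True; a' = Arrow c' u' X1 False in
     {Arrow (ColV a X2) c X2 False, Arrow (ColV a X3) c X3 False,
      Arrow (ColV b X1) m X1 False, Arrow (ColV b' X1) m X1 False,
      Arrow (ColV a' X2) c' X2 False, Arrow (ColV a' X3) c' X3 False})"

lemma diamond_vertices_piece_arrows:
  assumes "distinct (sources p)" "distinct (targets p)"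
  shows "diamond_vertices (I_rel :: (idx, 'k::field) mpoly set) (piece_arrows p) =
    (case p of Fork u u' v \<Rightarrow> {DiaV (Arrow u v X2 False) (Arrow u' v X3 False)} | _ \<Rightarrow> {})"
  using assms unfolding diamond_vertices_I_rel by (cases p) auto

lemma new_arrows_piece_arrows:
  assumes "distinct (sources p)" "distinct (targets p)"
  shows "new_arrows (I_rel :: (idx, 'k::field) mpoly set) (piece_arrows p) = new_piece_arrows p"
  unfolding new_arrows_def new_vertices_def diamond_vertices_piece_arrows[OF assms] column_vertices_I_rel
  by (cases p) (simp_all add: Let_def insert_commute)

lemma tgt_new_piece_arrows: "e \<in> new_piece_arrows p \<Longrightarrow> tgt e \<in> set (sources p)"
  by (cases p) (auto simp: Let_def)

text \<open>
  Target and label of one arrow leaving a new vertex. Identified vertices agree here while new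
  vertices that are not identified differ, so this invariant keeps track of which representative
  may have been chosen. The two initial vertices are never new, hence their value is arbitrary.
\<close>

fun leading :: "'x vertex \<Rightarrow> 'x vertex \<times> 'x" where
  "leading (ColV a j) = (src a, j)"
| "leading (DiaV a b) = (src a, lab b)"
| "leading _ = undefined"

lemma leading_new_piece_arrows:
  assumes "distinct (sources p)" "distinct (targets p)" "e \<in> new_piece_arrows p" "f \<in> new_piece_arrows p"
    "tgt e = tgt f" "lab e = lab f"
  shows "leading (src e) = leading (src f)"
  using assms by (cases p) (auto simp: Let_def)

lemma merged_identified: "(u, merged I A u) \<in> identified I A"
  unfolding merged_def by (rule someI[of _ u]) (simp add: identified_def)

lemma merged_invariant:
  assumes "\<And>e f. e \<in> new_arrows I A \<Longrightarrow> f \<in> new_arrows I A \<Longrightarrow> tgt e = tgt f \<Longrightarrow> lab e = lab f \<Longrightarrow>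
    h (src e) = h (src f)"
  shows "h (merged I A u) = h u"
proof -
  have "(u, merged I A u) \<in> {(src e, src f) | e f.
     e \<in> new_arrows I A \<and> f \<in> new_arrows I A \<and> tgt e = tgt f \<and> lab e = lab f}\<^sup>*"
    using merged_identified unfolding identified_def .
  then show ?thesis
  proof (induction rule: rtrancl_induct)
    case (step v w)
    from step.hyps(2) have "h v = h w" by (auto dest: assms)
    with step.IH show ?case by simp
  qed simp
qed

lemma merged_eqI:
  assumes "e \<in> new_arrows I A" "f \<in> new_arrows I A" "tgt e = tgt f" "lab e = lab f"
  shows "merged I A (src e) = merged I A (src f)"
proof -
  \<comment> \<open>By symmetry the two sources have the same class, and the representative depends only on the class.\<close>
  have "sym (identified I A)"
    unfolding identified_def by (rule sym_rtrancl) (force simp: sym_def)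
  moreover have "trans (identified I A)"
    unfolding identified_def by (rule trans_rtrancl)
  moreover have "(src e, src f) \<in> identified I A"
    unfolding identified_def using assms by blast
  ultimately have "(src e, u) \<in> identified I A \<longleftrightarrow> (src f, u) \<in> identified I A" for u
    by (meson symD transD)
  then show ?thesis unfolding merged_def by simp
qed

text \<open>
  The one merger: the two column vertices over the middle vertex of a zigzag have
  to have the same representative.
\<close>

lemma completion_piece:
  assumes d: "distinct (sources p)" "distinct (targets p)"
    and \<mu>: "\<And>e f. e \<in> new_piece_arrows p \<Longrightarrow> f \<in> new_piece_arrows p \<Longrightarrow> tgt e = tgt f \<Longrightarrow> lab e = lab f \<Longrightarrow>
      \<mu> (src e) = \<mu> (src f)"
  shows "(\<lambda>e. Arrow (\<mu> (src e)) (tgt e) (lab e)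
        (\<exists>f\<in>new_piece_arrows p. tgt f = tgt e \<and> lab f = lab e \<and> neg f)) ` new_piece_arrows p
    = (\<Union>q\<in>set (next_pieces \<mu> p). piece_arrows q)"
proof (cases p)
  case (Zigzag c m c' u u')
  have "\<mu> (ColV (Arrow m u' X2 True) X1) = \<mu> (ColV (Arrow m u X3 False) X1)"
    using \<mu>[of "Arrow (ColV (Arrow m u' X2 True) X1) m X1 False" "Arrow (ColV (Arrow m u X3 False) X1) m X1 False"]
    by (simp add: Zigzag Let_def)
  then show ?thesis using d by (simp add: Zigzag Let_def insert_commute)
qed (use d in \<open>auto simp: Let_def\<close>)

text \<open>
  The values of \<open>leading\<close> at the sources of the next pieces.
\<close>

fun leading_list :: "piece \<Rightarrow> (idx vertex \<times> idx) list" where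
  "leading_list (Edge v w) = [(v, X2), (v, X3)]"
| "leading_list (Fork u u' v) = [(u, X1), (u, X3), (u', X1)]"
| "leading_list (Zigzag c m c' u u') = [(c, X2), (c, X3), (m, X1), (c', X2), (c', X3)]"

lemma leading_sources_next_pieces:
  assumes "\<And>u. leading (\<mu> u) = leading u"
  shows "concat (map (\<lambda>q. map leading (sources q)) (next_pieces \<mu> p)) = leading_list p"
  by (cases p) (simp_all add: assms)

lemma fst_leading_list: "x \<in> set (leading_list p) \<Longrightarrow> fst x \<in> set (sources p)"
  by (cases p) auto

lemma distinct_leading_list: "distinct (sources p) \<Longrightarrow> distinct (leading_list p)"
  by (cases p) auto

lemma distinct_concat_leading_list:
  "distinct (concat (map sources ps)) \<Longrightarrow> distinct (concat (map leading_list ps))"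
proof (induction ps)
  case (Cons p ps)
  have "set (leading_list p) \<inter> set (concat (map leading_list ps)) = {}"
  proof (rule equals0I)
    fix x assume "x \<in> set (leading_list p) \<inter> set (concat (map leading_list ps))"
    then obtain q where "q \<in> set ps" "fst x \<in> set (sources p)" "fst x \<in> set (sources q)"
      by (auto dest: fst_leading_list)
    with Cons.prems show False by auto
  qed
  with Cons show ?case by (auto simp: distinct_leading_list)
qed simp

lemma concat_map_concat_map: "concat (map g (concat (map f xs))) = concat (map (\<lambda>x. concat (map g (f x))) xs)"
  by (induction xs) auto

text \<open>
  The targets of the next pieces are the sources of the old ones, so only the new
  sources could fail to be distinct. They are separated by \<open>leading\<close>, whose values over different
  old sources differ.
\<close>

lemma completion_pieces:
  fixes ps :: "piece list"
  defines "A \<equiv> \<Union>p\<in>set ps. piece_arrows p"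
  defines "\<mu> \<equiv> merged (I_rel :: (idx, 'k::field) mpoly set) A"
  defines "ps' \<equiv> concat (map (next_pieces \<mu>) ps)"
  assumes sep: "separated ps"
  shows "completion_arrows (I_rel :: (idx, 'k) mpoly set) A = (\<Union>p\<in>set ps'. piece_arrows p)"
    and "separated ps'"
proof -
  let ?I = "I_rel :: (idx, 'k) mpoly set"
  have new: "new_arrows ?I A = (\<Union>p\<in>set ps. new_piece_arrows p)"
    unfolding A_def new_arrows_I_rel_union[OF sep]
    using separated_distinct[OF sep] by (simp add: new_arrows_piece_arrows)
  have same: "p = q"
    if "p \<in> set ps" "q \<in> set ps" "e \<in> new_piece_arrows p" "f \<in> new_piece_arrows q" "tgt e = tgt f" for p q e f
    using that separated_sources_unique[OF sep] tgt_new_piece_arrows by metis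
  have lead: "leading (\<mu> u) = leading u" for u
    unfolding \<mu>_def
  proof (rule merged_invariant)
    fix e f assume "e \<in> new_arrows ?I A" "f \<in> new_arrows ?I A" and ef: "tgt e = tgt f" "lab e = lab f"
    then obtain p where "p \<in> set ps" "e \<in> new_piece_arrows p" "f \<in> new_piece_arrows p"
      unfolding new using same by blast
    with ef show "leading (src e) = leading (src f)"
      using separated_distinct[OF sep] leading_new_piece_arrows by blast
  qed
  define g where "g N e = Arrow (\<mu> (src e)) (tgt e) (lab e)
      (\<exists>f\<in>N. tgt f = tgt e \<and> lab f = lab e \<and> neg f)" for N and e :: "idx varrow"
  have local: "g (new_arrows ?I A) e = g (new_piece_arrows p) e" if "p \<in> set ps" "e \<in> new_piece_arrows p" for p e
  proof -
    have "f \<in> new_piece_arrows p" if "q \<in> set ps" "f \<in> new_piece_arrows q" "tgt f = tgt e" for q f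
      using same[OF that(1) \<open>p \<in> set ps\<close> that(2) \<open>e \<in> new_piece_arrows p\<close> that(3)] that(2) by simp
    then have "(\<exists>f\<in>\<Union>p\<in>set ps. new_piece_arrows p. tgt f = tgt e \<and> lab f = lab e \<and> neg f) \<longleftrightarrow>
        (\<exists>f\<in>new_piece_arrows p. tgt f = tgt e \<and> lab f = lab e \<and> neg f)"
      using \<open>p \<in> set ps\<close> by blast
    then show ?thesis unfolding g_def new by simp
  qed
  have piece: "g (new_piece_arrows p) ` new_piece_arrows p = (\<Union>q\<in>set (next_pieces \<mu> p). piece_arrows q)"
    if p: "p \<in> set ps" for p
    unfolding g_def
  proof (rule completion_piece)
    show "distinct (sources p)" "distinct (targets p)" using separated_distinct[OF sep p] by auto
    fix e f assume "e \<in> new_piece_arrows p" "f \<in> new_piece_arrows p" "tgt e = tgt f" "lab e = lab f"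
    then show "\<mu> (src e) = \<mu> (src f)"
      unfolding \<mu>_def using p by (intro merged_eqI) (auto simp: new)
  qed
  have "completion_arrows ?I A = g (new_arrows ?I A) ` new_arrows ?I A"
    unfolding completion_arrows_def g_def \<mu>_def ..
  also have "\<dots> = (\<Union>p\<in>set ps. g (new_arrows ?I A) ` new_piece_arrows p)"
    by (subst (2) new) blast
  also have "\<dots> = (\<Union>p\<in>set ps. g (new_piece_arrows p) ` new_piece_arrows p)"
    by (intro SUP_cong refl image_cong local)
  also have "\<dots> = (\<Union>p\<in>set ps'. piece_arrows p)"
    unfolding ps'_def by (auto simp: piece)
  finally show "completion_arrows ?I A = (\<Union>p\<in>set ps'. piece_arrows p)" .
  have "map leading (concat (map sources ps')) = concat (map leading_list ps)"
    unfolding ps'_def concat_map_concat_map by (simp add: map_concat leading_sources_next_pieces[OF lead] comp_def)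
  then have "distinct (concat (map sources ps'))"
    using distinct_concat_leading_list sep unfolding separated_def by (metis distinct_map)
  moreover have "concat (map targets ps') = concat (map sources ps)"
    unfolding ps'_def concat_map_concat_map concat_targets_next_pieces ..
  ultimately show "separated ps'" using sep unfolding separated_def by simp
qed

lemma completion_vertices_eq_src: "completion_vertices I A = src ` completion_arrows I A"
proof -
  have "src ` new_arrows I A = new_vertices I A"
  proof -
    have "src ` new_arrows_from u = {u}" if "u \<in> new_vertices I A" for u
      using that unfolding new_vertices_def column_vertices_def diamond_vertices_def by auto
    then show ?thesis unfolding new_arrows_def by (simp add: image_UN)
  qed
  then show ?thesis
    unfolding completion_vertices_def completion_arrows_def by (auto simp: image_image simp flip: image_image[of "merged I A" src])
qed

text \<open>
  The pieces that make up the arrows from degree \<open>n + 1\<close> to degree \<open>n\<close>.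
\<close>

primrec pieces :: "(idx, 'k::field) mpoly set \<Rightarrow> nat \<Rightarrow> piece list" where
  "pieces I 0 = [Edge Deg1 Deg0]"
| "pieces I (Suc n) = concat (map (next_pieces (merged I (arrows I X1 (Suc n)))) (pieces I n))"

lemma arrows_pieces:
  fixes n :: nat
  defines "ps \<equiv> pieces (I_rel :: (idx, 'k::field) mpoly set)"
  shows "arrows (I_rel :: (idx, 'k) mpoly set) X1 (Suc n) = (\<Union>p\<in>set (ps n). piece_arrows p)"
    and "separated (ps n)"
proof (induction n)
  case 0
  { case 1 show ?case by (simp add: ps_def) }
  { case 2 show ?case by (simp add: ps_def separated_def) }
next
  case (Suc n)
  have *: "ps (Suc n) = concat (map (next_pieces (merged (I_rel :: (idx, 'k) mpoly set) (\<Union>p\<in>set (ps n). piece_arrows p))) (ps n))"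
    using Suc(1) by (simp add: ps_def)
  { case 1 show ?case unfolding * using Suc completion_pieces(1)[OF Suc(2)] by simp }
  { case 2 show ?case unfolding * by (rule completion_pieces(2)[OF Suc(2)]) }
qed

text \<open>
  Each vertex of degree \<open>n\<close> is the target of arrows from degree \<open>n + 1\<close>, so the pieces above it
  put the vertices of degree \<open>n\<close> in order. The order from the pieces below is the same, by
  \<open>basis_Suc\<close>; this is what makes all matrices block diagonal at once.
\<close>

definition basis :: "(idx, 'k::field) mpoly set \<Rightarrow> nat \<Rightarrow> idx vertex list" where
  "basis I n = concat (map targets (pieces I n))"

lemma basis_Suc: "basis I (Suc n) = concat (map sources (pieces I n))"
  unfolding basis_def by (simp add: concat_map_concat_map concat_targets_next_pieces)

lemma distinct_basis: "distinct (basis (I_rel :: (idx, 'k::field) mpoly set) n)"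
  using arrows_pieces(2)[where 'k='k] unfolding basis_def separated_def by blast

lemma vertices_basis: "vertices (I_rel :: (idx, 'k::field) mpoly set) X1 n = set (basis (I_rel :: (idx, 'k) mpoly set) n)"
proof (cases n)
  case 0 then show ?thesis by (simp add: basis_def)
next
  case (Suc m)
  have "vertices (I_rel :: (idx, 'k::field) mpoly set) X1 (Suc m) = src ` arrows (I_rel :: (idx, 'k) mpoly set) X1 (Suc m)"
    by (cases m) (simp_all add: completion_vertices_eq_src)
  also have "\<dots> = set (basis (I_rel :: (idx, 'k) mpoly set) (Suc m))"
    unfolding arrows_pieces(1) basis_Suc by (simp add: image_UN src_piece_arrows)
  finally show ?thesis using Suc by simp
qed

section \<open>Free modules\<close>

lemma lookup_free_scale: "Poly_Mapping.lookup (free_scale r p) x = r * Poly_Mapping.lookup p x"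
  unfolding free_scale_def by (simp add: Poly_Mapping.map.rep_eq when_def)

lemma module_free_scale: "Modules.module (free_scale :: 'r::comm_ring_1 \<Rightarrow> ('v \<Rightarrow>\<^sub>0 'r) \<Rightarrow> _)"
  by (rule Modules.module.intro; rule poly_mapping_eqI)
    (simp_all add: lookup_free_scale lookup_add algebra_simps)

lemma free_submodule_free_module_on:
  "free_submodule free_scale (free_module_on V :: ('v \<Rightarrow>\<^sub>0 'r::comm_ring_1) set)"
proof -
  define e where "e v = (Poly_Mapping.single v 1 :: 'v \<Rightarrow>\<^sub>0 'r)" for v
  have inj: "inj e"
    unfolding e_def by (rule injI) (metis lookup_single_eq lookup_single_not_eq one_neq_zero)
  have [simp]: "Poly_Mapping.lookup (free_scale r (e v)) w = (if v = w then r else 0)" for r v w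
    by (simp add: e_def lookup_free_scale lookup_single when_def)
  have "\<not> Modules.module.dependent free_scale (e ` V)"
    unfolding Modules.module.independent_explicit_module[OF module_free_scale]
  proof (intro allI impI)
    fix t u b
    assume t: "finite t" "t \<subseteq> e ` V" "b \<in> t" and zero: "(\<Sum>b\<in>t. free_scale (u b) b) = (0 :: 'v \<Rightarrow>\<^sub>0 'r)"
    obtain W where W: "W \<subseteq> V" "t = e ` W" using t(2) by (meson subset_imageE)
    then obtain v where v: "v \<in> W" "b = e v" using t(3) by blast
    have "finite W" using t(1) W(2) inj by (metis finite_imageD inj_on_subset subset_UNIV)
    have "0 = Poly_Mapping.lookup (\<Sum>w\<in>W. free_scale (u (e w)) (e w)) v"
      using zero inj by (simp add: W(2) sum.reindex inj_on_def)
    also have "\<dots> = u b"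
      using \<open>finite W\<close> v by (simp add: lookup_sum)
    finally show "u b = 0" by simp
  qed
  moreover have "Modules.module.span free_scale (e ` V) = (free_module_on V :: ('v \<Rightarrow>\<^sub>0 'r) set)"
  proof (rule Modules.module.span_subspace[OF module_free_scale])
    show "e ` V \<subseteq> free_module_on V" by (auto simp: e_def free_module_on_def)
    show "Modules.module.subspace free_scale (free_module_on V :: ('v \<Rightarrow>\<^sub>0 'r) set)"
      unfolding Modules.module.subspace_def[OF module_free_scale] free_module_on_def
      by (auto simp: subset_iff in_keys_iff lookup_add lookup_free_scale)
        (metis add.right_neutral, metis mult_zero_right)
    show "(free_module_on V :: ('v \<Rightarrow>\<^sub>0 'r) set) \<subseteq> Modules.module.span free_scale (e ` V)"
    proof
      fix p :: "'v \<Rightarrow>\<^sub>0 'r" assume p: "p \<in> free_module_on V"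
      have "p = (\<Sum>v\<in>Poly_Mapping.keys p. free_scale (Poly_Mapping.lookup p v) (e v))"
        by (rule poly_mapping_eqI) (auto simp: lookup_sum in_keys_iff)
      moreover have "\<dots> \<in> Modules.module.span free_scale (e ` V)"
        using p unfolding free_module_on_def
        by (intro Modules.module.span_sum[OF module_free_scale] Modules.module.span_scale[OF module_free_scale]
            Modules.module.span_base[OF module_free_scale]) auto
      ultimately show "p \<in> Modules.module.span free_scale (e ` V)" by simp
    qed
  qed
  ultimately show ?thesis unfolding free_submodule_def by blast
qed

lemma free_module_on_eqI:
  assumes "p \<in> free_module_on V" "q \<in> free_module_on V"
    "\<And>v. v \<in> V \<Longrightarrow> Poly_Mapping.lookup p v = Poly_Mapping.lookup q v"
  shows "p = q"
  using assms unfolding free_module_on_def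
  by (intro poly_mapping_eqI) (metis in_keys_iff mem_Collect_eq subsetD)

lemma free_module_on_realize:
  assumes "finite V"
  obtains p where "p \<in> free_module_on V" "\<And>v. v \<in> V \<Longrightarrow> Poly_Mapping.lookup p v = f v"
proof
  let ?p = "\<Sum>v\<in>V. Poly_Mapping.single v (f v)"
  have p: "Poly_Mapping.lookup ?p w = (if w \<in> V then f w else 0)" for w
    using assms by (simp add: lookup_sum lookup_single when_def)
  then show "\<And>v. v \<in> V \<Longrightarrow> Poly_Mapping.lookup ?p v = f v" by simp
  show "?p \<in> free_module_on V" unfolding free_module_on_def by (auto simp: in_keys_iff p split: if_splits)
qed

section \<open>The differential\<close>

definition coefficient :: "('x \<Rightarrow> 'r::comm_ring_1) \<Rightarrow> 'x varrow \<Rightarrow> 'r" where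
  "coefficient \<xi> a = (if neg a then - \<xi> (lab a) else \<xi> (lab a))"

text \<open>
  The definition sums over vertices; grouping the arrows into a fixed target by their sources
  turns this into a sum over arrows.
\<close>

lemma lookup_differential:
  assumes "finite (vertices I i (n - 1))" "finite (arrows I i n)"
  shows "Poly_Mapping.lookup (differential I i \<xi> n p) w =
    (if w \<in> vertices I i (n - 1)
     then \<Sum>a\<in>{a \<in> arrows I i n. tgt a = w}. coefficient \<xi> a * Poly_Mapping.lookup p (src a) else 0)"
proof -
  let ?S = "{a \<in> arrows I i n. tgt a = w}" and ?K = "Poly_Mapping.keys p"
  let ?h = "\<lambda>a. coefficient \<xi> a * Poly_Mapping.lookup p (src a)"
  have fin: "finite ?S" using assms(2) by simp
  have comp: "component I i \<xi> n v w * Poly_Mapping.lookup p v = (\<Sum>a\<in>{a \<in> ?S. src a = v}. ?h a)" for v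
    unfolding component_def coefficient_def sum_distrib_right
    by (rule sum.cong) auto
  have "(\<Sum>v\<in>?K. component I i \<xi> n v w * Poly_Mapping.lookup p v)
      = (\<Sum>v\<in>?K \<union> src ` ?S. component I i \<xi> n v w * Poly_Mapping.lookup p v)"
    using fin by (intro sum.mono_neutral_left) (auto simp: in_keys_iff)
  also have "\<dots> = (\<Sum>a\<in>?S. ?h a)"
    unfolding comp by (rule sum.group) (use fin in auto)
  finally have sum: "(\<Sum>v\<in>?K. component I i \<xi> n v w * Poly_Mapping.lookup p v) = (\<Sum>a\<in>?S. ?h a)" .
  have "Poly_Mapping.lookup (differential I i \<xi> n p) w =
      (\<Sum>v\<in>?K. if w \<in> vertices I i (n - 1) then component I i \<xi> n v w * Poly_Mapping.lookup p v else 0)"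
    unfolding differential_def lookup_sum
    using assms(1) by (intro sum.cong refl) (simp add: lookup_single when_def)
  then show ?thesis using sum by simp
qed

text \<open>
  The differential over the ring in question. Fixing the type of its argument also fixes the field
  in the ideal that the diagram is built from.
\<close>

abbreviation (input) bd :: "nat \<Rightarrow> (idx vertex \<Rightarrow>\<^sub>0 'k::field qring) \<Rightarrow> (idx vertex \<Rightarrow>\<^sub>0 'k qring)" where
  "bd \<equiv> differential (I_rel :: (idx, 'k) mpoly set) X1 xvar"

lemma finite_piece_arrows: "finite (piece_arrows p)"
  by (cases p) auto

lemma finite_arrows: "finite (arrows (I_rel :: (idx, 'k::field) mpoly set) X1 n)"
  by (cases n) (simp_all add: arrows_pieces(1) finite_piece_arrows)

lemma finite_vertices: "finite (vertices (I_rel :: (idx, 'k::field) mpoly set) X1 n)"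
  by (simp add: vertices_basis)

lemmas lookup_bd = lookup_differential[OF finite_vertices finite_arrows]

lemma linear_bd: "linear_on free_scale free_scale P (bd n)"
  unfolding linear_on_def
  by (auto intro!: poly_mapping_eqI
    simp: lookup_bd lookup_free_scale lookup_add sum.distrib sum_distrib_left algebra_simps)

lemma bd_in_chain_module:
  "bd n (p :: _ \<Rightarrow>\<^sub>0 'k::field qring) \<in> chain_module (I_rel :: (idx, 'k) mpoly set) X1 (n - 1)"
  unfolding chain_module_def free_module_on_def by (auto simp: in_keys_iff lookup_bd split: if_splits)

text \<open>
  The part of the differential that belongs to a piece, with values listed in the order of
  the targets.
\<close>

fun piece_map :: "piece \<Rightarrow> (idx vertex \<Rightarrow> 'k::field qring) \<Rightarrow> 'k qring list" where
  "piece_map (Edge v w) f = [xvar X1 * f v]"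
| "piece_map (Fork u u' v) f = [xvar X2 * f u + xvar X3 * f u']"
| "piece_map (Zigzag c m c' u u') f =
     [xvar X1 * f c + xvar X3 * f m, - xvar X2 * f m + xvar X1 * f c']"

lemma piece_map_cong: "(\<And>v. v \<in> set (sources p) \<Longrightarrow> f v = g v) \<Longrightarrow> piece_map p f = piece_map p g"
  by (cases p) auto

lemma arrows_into_piece:
  assumes "p \<in> set (pieces (I_rel :: (idx, 'k::field) mpoly set) n)" "w \<in> set (targets p)"
  shows "{a \<in> arrows (I_rel :: (idx, 'k) mpoly set) X1 (Suc n). tgt a = w} = {a \<in> piece_arrows p. tgt a = w}"
proof -
  have "a \<in> piece_arrows p"
    if "q \<in> set (pieces (I_rel :: (idx, 'k) mpoly set) n)" "a \<in> piece_arrows q" "tgt a = w" for q a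
    using separated_targets_unique[OF arrows_pieces(2) assms(1) that(1) assms(2)] tgt_in_targets[OF that(2)] that
    by simp
  then show ?thesis unfolding arrows_pieces(1) using assms(1) by auto
qed

lemma targets_in_vertices:
  assumes "p \<in> set (pieces (I_rel :: (idx, 'k::field) mpoly set) n)" "w \<in> set (targets p)"
  shows "w \<in> vertices (I_rel :: (idx, 'k) mpoly set) X1 n"
  unfolding vertices_basis basis_def using assms by auto

lemma bd_piece:
  fixes f :: "idx vertex \<Rightarrow>\<^sub>0 'k::field qring"
  assumes p: "p \<in> set (pieces (I_rel :: (idx, 'k) mpoly set) n)"
  shows "map (Poly_Mapping.lookup (bd (Suc n) f)) (targets p) = piece_map p (Poly_Mapping.lookup f)"
proof -
  have eq: "Poly_Mapping.lookup (bd (Suc n) f) w =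
      (\<Sum>a\<in>{a \<in> piece_arrows p. tgt a = w}. coefficient xvar a * Poly_Mapping.lookup f (src a))"
    if "w \<in> set (targets p)" for w
    using that targets_in_vertices[OF p that] by (simp only: lookup_bd arrows_into_piece[OF p]) simp
  have d: "distinct (sources p)" "distinct (targets p)" using separated_distinct[OF arrows_pieces(2) p] by auto
  show ?thesis
  proof (cases p)
    case (Edge v w)
    have "{a \<in> piece_arrows p. tgt a = w} = {Arrow v w X1 False}"
      using d unfolding Edge by auto
    then show ?thesis using eq by (simp add: Edge coefficient_def)
  next
    case (Fork u u' v)
    have "{a \<in> piece_arrows p. tgt a = v} = {Arrow u v X2 False, Arrow u' v X3 False}"
      using d unfolding Fork by auto
    then show ?thesis using eq d by (simp add: Fork coefficient_def)
  next
    case (Zigzag c m c' u u')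
    have "{a \<in> piece_arrows p. tgt a = u} = {Arrow c u X1 False, Arrow m u X3 False}"
      "{a \<in> piece_arrows p. tgt a = u'} = {Arrow m u' X2 True, Arrow c' u' X1 False}"
      using d unfolding Zigzag by auto
    then show ?thesis using eq d by (simp add: Zigzag coefficient_def)
  qed
qed

section \<open>Exactness\<close>

lemma piece_complex:
  assumes "concat (map (\<lambda>q. piece_map q g) (next_pieces \<mu> p)) = map f (sources p)"
  shows "set (piece_map p f) \<subseteq> {0}"
proof -
  have eqs: "xvar X1 * (xvar X2 * a) = 0" "xvar X2 * (xvar X1 * a) = 0"
    "xvar X1 * (xvar X3 * a) = 0" "xvar X3 * (xvar X1 * a) = 0" for a :: "'a qring"
    using xvar_mult_zero by (metis mult.commute mult.left_commute mult_zero_right)+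
  show ?thesis
  proof (cases p)
    case (Edge v w)
    obtain a b where "f v = xvar X2 * a + xvar X3 * b"
      using assms unfolding Edge by (simp, metis)
    then show ?thesis by (simp add: Edge distrib_left eqs)
  next
    case (Fork u u' v)
    obtain a b c where "f u = xvar X1 * a + xvar X3 * b" "f u' = - xvar X2 * b + xvar X1 * c"
      using assms unfolding Fork by (simp, metis)
    then show ?thesis
      by (simp add: Fork distrib_left right_diff_distrib eqs mult.left_commute[of "xvar X3" "xvar X2"])
  next
    case (Zigzag c m c' u u')
    obtain s t r s' t' where "f c = xvar X2 * s + xvar X3 * t" "f m = xvar X1 * r"
        "f c' = xvar X2 * s' + xvar X3 * t'"
      using assms unfolding Zigzag by (simp, metis)
    then show ?thesis by (simp add: Zigzag distrib_left eqs)
  qed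
qed

text \<open>
  The preimage can be prescribed freely because the sources of the next pieces are distinct. For a
  zigzag, \<open>(x1) \<inter> (x3) = 0\<close> and \<open>(x1) \<inter> (x2) = 0\<close> decouple the two equations into one
  annihilator condition for each of the three coordinates.
\<close>

lemma piece_exact:
  fixes f :: "idx vertex \<Rightarrow> 'k::field qring"
  assumes zero: "set (piece_map p f) \<subseteq> {0}"
    and dist: "distinct (concat (map sources (next_pieces \<mu> p)))"
  shows "\<exists>g. concat (map (\<lambda>q. piece_map q g) (next_pieces \<mu> p)) = map f (sources p)"
proof (cases p)
  case (Edge v w)
  obtain s t where st: "f v = xvar X2 * s + xvar X3 * t"
    using zero annihilator_x1[of "f v"] unfolding Edge by (simp, blast)
  define y2 where "y2 = \<mu> (ColV (Arrow v w X1 False) X2)"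
  define y3 where "y3 = \<mu> (ColV (Arrow v w X1 False) X3)"
  show ?thesis
    using dist unfolding Edge
    by (intro exI[of _ "(\<lambda>_. 0)(y2 := s, y3 := t)"]) (simp flip: y2_def y3_def add: st)
next
  case (Fork u u' v)
  obtain a b c where abc: "f u = xvar X1 * a + xvar X3 * b" "f u' = xvar X1 * c - xvar X2 * b"
    using zero syzygy_x2_x3[of "f u" "f u'"] unfolding Fork by (simp, blast)
  define y1 where "y1 = \<mu> (ColV (Arrow u v X2 False) X1)"
  define y2 where "y2 = \<mu> (DiaV (Arrow u v X2 False) (Arrow u' v X3 False))"
  define y3 where "y3 = \<mu> (ColV (Arrow u' v X3 False) X1)"
  show ?thesis
    using dist unfolding Fork
    by (intro exI[of _ "(\<lambda>_. 0)(y1 := a, y2 := b, y3 := c)"]) (auto simp flip: y1_def y2_def y3_def simp: abc)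
next
  case (Zigzag c m c' u u')
  \<comment> \<open>The sign moves to the coefficient, so that each equation is a sum of an \<open>x1\<close>-multiple and another one.\<close>
  have eqs: "xvar X1 * f c + xvar X3 * f m = 0" "xvar X1 * f c' + xvar X2 * (- f m) = 0"
    using zero unfolding Zigzag by (simp_all add: algebra_simps)
  then have "xvar X1 * f c = 0" "xvar X3 * f m = 0" "xvar X1 * f c' = 0"
    using x1_multiples_meet_trivially[OF eqs(1)] x1_multiples_meet_trivially[OF eqs(2)] by simp_all
  then obtain s t r s' t' where st: "f c = xvar X2 * s + xvar X3 * t" "f m = xvar X1 * r"
      "f c' = xvar X2 * s' + xvar X3 * t'"
    using annihilator_x1 annihilator_x3 by meson
  define y1 where "y1 = \<mu> (ColV (Arrow c u X1 False) X2)"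
  define y2 where "y2 = \<mu> (ColV (Arrow c u X1 False) X3)"
  define y3 where "y3 = \<mu> (ColV (Arrow m u X3 False) X1)"
  define y4 where "y4 = \<mu> (ColV (Arrow c' u' X1 False) X2)"
  define y5 where "y5 = \<mu> (ColV (Arrow c' u' X1 False) X3)"
  show ?thesis
    using dist unfolding Zigzag
    by (intro exI[of _ "(\<lambda>_. 0)(y1 := s, y2 := t, y3 := r, y4 := s', y5 := t')"])
      (auto simp flip: y1_def y2_def y3_def y4_def y5_def simp: st)
qed

text \<open>
  Conditions on the restrictions of a function to disjoint sets can be satisfied simultaneously. It
  combines preimages found piece by piece into one preimage.
\<close>

lemma glue_functions:
  assumes "distinct (concat (map S xs))"
    and "\<And>x. x \<in> set xs \<Longrightarrow> \<exists>g. Q x g"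
    and "\<And>x g h. (\<And>y. y \<in> set (S x) \<Longrightarrow> g y = h y) \<Longrightarrow> Q x g \<Longrightarrow> Q x h"
  shows "\<exists>g. \<forall>x\<in>set xs. Q x g"
  using assms(1,2)
proof (induction xs)
  case (Cons x xs)
  obtain g where g: "Q x g" using Cons.prems(2)[of x] by auto
  obtain h where h: "\<forall>x\<in>set xs. Q x h" using Cons by auto
  define k where "k y = (if y \<in> set (S x) then g y else h y)" for y
  have "Q x k" using assms(3)[OF _ g] by (simp add: k_def)
  moreover have "Q x' k" if "x' \<in> set xs" for x'
  proof (rule assms(3)[of x' h])
    show "Q x' h" using h that by blast
    fix y assume "y \<in> set (S x')"
    then have "y \<notin> set (S x)" using Cons.prems(1) that by auto
    then show "h y = k y" by (simp add: k_def)
  qed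
  ultimately show ?case by auto
qed simp

lemma bd_eq_zero_iff:
  fixes f :: "idx vertex \<Rightarrow>\<^sub>0 'k::field qring"
  shows "bd (Suc n) f = 0 \<longleftrightarrow>
    (\<forall>p\<in>set (pieces (I_rel :: (idx, 'k) mpoly set) n). set (piece_map p (Poly_Mapping.lookup f)) \<subseteq> {0})"
proof -
  let ?I = "I_rel :: (idx, 'k) mpoly set"
  have "0 \<in> (free_module_on (vertices ?I X1 n) :: (_ \<Rightarrow>\<^sub>0 'k qring) set)"
    by (simp add: free_module_on_def)
  then have "bd (Suc n) f = 0 \<longleftrightarrow> (\<forall>v\<in>vertices ?I X1 n. Poly_Mapping.lookup (bd (Suc n) f) v = 0)"
    using free_module_on_eqI[of "bd (Suc n) f" "vertices ?I X1 n" 0] bd_in_chain_module[of "Suc n" f]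
    by (auto simp: chain_module_def)
  also have "\<dots> \<longleftrightarrow> (\<forall>p\<in>set (pieces ?I n).
      set (map (Poly_Mapping.lookup (bd (Suc n) f)) (targets p)) \<subseteq> {0})"
    unfolding vertices_basis basis_def by auto
  finally show ?thesis by (simp only: bd_piece cong: ball_cong)
qed

text \<open>
  The targets of the pieces that follow \<open>p\<close> are the sources of \<open>p\<close>, so whether a chain is a boundary
  is decided by one condition for each piece.
\<close>

lemma bd_eq_iff:
  fixes f g :: "idx vertex \<Rightarrow>\<^sub>0 'k::field qring"
  defines "\<mu> \<equiv> \<lambda>n. merged (I_rel :: (idx, 'k) mpoly set) (arrows (I_rel :: (idx, 'k) mpoly set) X1 (Suc n))"
  assumes f: "f \<in> chain_module (I_rel :: (idx, 'k) mpoly set) X1 (Suc n)"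
  shows "bd (Suc (Suc n)) g = f \<longleftrightarrow>
    (\<forall>p\<in>set (pieces (I_rel :: (idx, 'k) mpoly set) n).
       concat (map (\<lambda>q. piece_map q (Poly_Mapping.lookup g)) (next_pieces (\<mu> n) p))
         = map (Poly_Mapping.lookup f) (sources p))"
proof -
  let ?ps = "pieces (I_rel :: (idx, 'k) mpoly set) n"
  have ps': "pieces (I_rel :: (idx, 'k) mpoly set) (Suc n) = concat (map (next_pieces (\<mu> n)) ?ps)"
    by (simp add: \<mu>_def)
  have "concat (map (\<lambda>q. piece_map q (Poly_Mapping.lookup g)) (next_pieces (\<mu> n) p))
      = concat (map (\<lambda>q. map (Poly_Mapping.lookup (bd (Suc (Suc n)) g)) (targets q)) (next_pieces (\<mu> n) p))"
    if "p \<in> set ?ps" for p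
    using that by (intro arg_cong[of _ _ concat] map_cong refl bd_piece[symmetric]) (auto simp: ps' simp del: pieces.simps)
  also have "concat (map (\<lambda>q. map h (targets q)) (next_pieces (\<mu> n) p)) = map h (sources p)" for h :: "_ \<Rightarrow> 'k qring" and p
    by (simp flip: concat_targets_next_pieces[of "\<mu> n" p] add: map_concat comp_def)
  finally have eq: "concat (map (\<lambda>q. piece_map q (Poly_Mapping.lookup g)) (next_pieces (\<mu> n) p)) =
      map (Poly_Mapping.lookup (bd (Suc (Suc n)) g)) (sources p)" if "p \<in> set ?ps" for p
    using that by simp
  have "bd (Suc (Suc n)) g = f \<longleftrightarrow> (\<forall>v\<in>vertices (I_rel :: (idx, 'k) mpoly set) X1 (Suc n).
      Poly_Mapping.lookup (bd (Suc (Suc n)) g) v = Poly_Mapping.lookup f v)"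
    using free_module_on_eqI[of "bd (Suc (Suc n)) g" _ f] f bd_in_chain_module[of "Suc (Suc n)" g]
    unfolding chain_module_def by auto
  also have "\<dots> \<longleftrightarrow> (\<forall>p\<in>set ?ps. map (Poly_Mapping.lookup (bd (Suc (Suc n)) g)) (sources p) =
      map (Poly_Mapping.lookup f) (sources p))"
    unfolding vertices_basis basis_Suc by auto
  finally show ?thesis using eq by simp
qed

lemma kernel_eq_image:
  "{f \<in> chain_module (I_rel :: (idx, 'k::field) mpoly set) X1 (Suc n). bd (Suc n) f = (0 :: _ \<Rightarrow>\<^sub>0 'k qring)}
     = bd (Suc (Suc n)) ` chain_module (I_rel :: (idx, 'k) mpoly set) X1 (Suc (Suc n))"
proof (intro equalityI subsetI)
  let ?I = "I_rel :: (idx, 'k) mpoly set"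
  fix f :: "idx vertex \<Rightarrow>\<^sub>0 'k qring"
  assume "f \<in> bd (Suc (Suc n)) ` chain_module ?I X1 (Suc (Suc n))"
  then obtain g :: "idx vertex \<Rightarrow>\<^sub>0 'k qring" where g: "bd (Suc (Suc n)) g = f" by auto
  then have f: "f \<in> chain_module ?I X1 (Suc n)"
    using bd_in_chain_module[of "Suc (Suc n)" g] by simp
  have "bd (Suc n) f = 0"
    unfolding bd_eq_zero_iff using g[unfolded bd_eq_iff[OF f]] piece_complex by blast
  with f show "f \<in> {f \<in> chain_module ?I X1 (Suc n). bd (Suc n) f = 0}" by simp
next
  let ?I = "I_rel :: (idx, 'k) mpoly set"
  let ?\<mu> = "merged ?I (arrows ?I X1 (Suc n))"
  let ?S = "\<lambda>p. concat (map sources (next_pieces ?\<mu> p))"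
  let ?Q = "\<lambda>f p g. concat (map (\<lambda>q. piece_map q g) (next_pieces ?\<mu> p)) = map (Poly_Mapping.lookup f) (sources p)"
  fix f :: "idx vertex \<Rightarrow>\<^sub>0 'k qring"
  assume "f \<in> {f \<in> chain_module ?I X1 (Suc n). bd (Suc n) f = 0}"
  then have f: "f \<in> chain_module ?I X1 (Suc n)"
    and zero: "\<And>p. p \<in> set (pieces ?I n) \<Longrightarrow> set (piece_map p (Poly_Mapping.lookup f)) \<subseteq> {0}"
    unfolding bd_eq_zero_iff by auto
  have S: "concat (map ?S (pieces ?I n)) = basis ?I (Suc (Suc n))"
    by (simp add: basis_Suc concat_map_concat_map)
  then have dist: "distinct (concat (map ?S (pieces ?I n)))" by (metis distinct_basis)
  have cong: "?Q f p h" if "\<forall>y\<in>set (?S p). g y = h y" "?Q f p g" for p g h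
  proof -
    have "map (\<lambda>q. piece_map q h) (next_pieces ?\<mu> p) = map (\<lambda>q. piece_map q g) (next_pieces ?\<mu> p)"
      using that(1) by (intro map_cong refl piece_map_cong) force
    with that(2) show ?thesis by (simp only:)
  qed
  have "\<exists>g. \<forall>p\<in>set (pieces ?I n). ?Q f p g"
  proof (rule glue_functions[OF dist, where Q = "?Q f"])
    fix p g h assume "\<And>y. y \<in> set (?S p) \<Longrightarrow> g y = h y" "?Q f p g"
    then show "?Q f p h" using cong[of p g h] by blast
  next
    fix p assume "p \<in> set (pieces ?I n)"
    then show "\<exists>g. ?Q f p g"
      using zero dist by (intro piece_exact) (auto dest: distinct_concat_map_member)
  qed
  then obtain g where g: "\<And>p. p \<in> set (pieces ?I n) \<Longrightarrow> ?Q f p g" by blast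
  obtain g' where g': "g' \<in> free_module_on (vertices ?I X1 (Suc (Suc n)))"
    "\<And>v. v \<in> vertices ?I X1 (Suc (Suc n)) \<Longrightarrow> Poly_Mapping.lookup g' v = g v"
    using free_module_on_realize[OF finite_vertices, where f = g] by blast
  have "?Q f p (Poly_Mapping.lookup g')" if p: "p \<in> set (pieces ?I n)" for p
  proof (rule cong[OF _ g[OF p]], rule ballI)
    fix y assume "y \<in> set (?S p)"
    then have "y \<in> vertices ?I X1 (Suc (Suc n))"
      unfolding vertices_basis S[symmetric] using p by auto
    then show "g y = Poly_Mapping.lookup g' y" using g'(2) by simp
  qed
  then have "bd (Suc (Suc n)) g' = f" unfolding bd_eq_iff[OF f] by blast
  then show "f \<in> bd (Suc (Suc n)) ` chain_module ?I X1 (Suc (Suc n))"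
    using g'(1) unfolding chain_module_def by blast
qed

section \<open>The resolution\<close>

lemma module_cyc_scale: "Modules.module (cyc_scale :: 'k::field qring \<Rightarrow> 'k cyc \<Rightarrow> 'k cyc)"
proof (rule Modules.module.intro)
  fix r s :: "'k qring" and m m' :: "'k cyc"
  obtain a b where [simp]: "m = abs_cyc a" "m' = abs_cyc b"
    by (metis Quotient_abs_rep[OF Quotient_cyc])
  show "cyc_scale r (m + m') = cyc_scale r m + cyc_scale r m'"
    "cyc_scale (r + s) m = cyc_scale r m + cyc_scale s m"
    "cyc_scale r (cyc_scale s m) = cyc_scale (r * s) m"
    "cyc_scale 1 m = m"
    by (simp_all add: cyc_scale_abs_cyc plus_cyc.abs_eq algebra_simps)
qed

text \<open>
  In degree 0 both sides consist of the multiples of \<open>x1\<close>.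
\<close>

lemma kernel_augmentation:
  "{f \<in> chain_module (I_rel :: (idx, 'k::field) mpoly set) X1 0. augmentation f = (0 :: 'k cyc)}
     = bd 1 ` chain_module (I_rel :: (idx, 'k) mpoly set) X1 1"
proof -
  let ?I = "I_rel :: (idx, 'k) mpoly set"
  have zero: "augmentation f = 0 \<longleftrightarrow> (\<exists>r. Poly_Mapping.lookup f Deg0 = xvar X1 * r)"
    for f :: "idx vertex \<Rightarrow>\<^sub>0 'k qring"
    unfolding augmentation_def zero_cyc_def cyc.abs_eq_iff in_ideal_gen_single by (simp add: mult.commute)
  have bd: "Poly_Mapping.lookup (bd 1 g) Deg0 = xvar X1 * Poly_Mapping.lookup g Deg1"
    for g :: "idx vertex \<Rightarrow>\<^sub>0 'k qring"
    using bd_piece[of "Edge Deg1 Deg0" 0 g] by simp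
  show ?thesis
  proof (intro equalityI subsetI)
    fix f :: "idx vertex \<Rightarrow>\<^sub>0 'k qring"
    assume "f \<in> {f \<in> chain_module ?I X1 0. augmentation f = 0}"
    then obtain r where f: "f \<in> chain_module ?I X1 0" and r: "Poly_Mapping.lookup f Deg0 = xvar X1 * r"
      using zero by auto
    let ?g = "Poly_Mapping.single Deg1 r"
    have "?g \<in> chain_module ?I X1 1"
      by (simp add: chain_module_def free_module_on_def)
    moreover have "f = bd 1 ?g"
    proof (rule free_module_on_eqI)
      show "f \<in> free_module_on (vertices ?I X1 0)" "bd 1 ?g \<in> free_module_on (vertices ?I X1 0)"
        using f bd_in_chain_module[of 1 ?g] unfolding chain_module_def by simp_all
      show "Poly_Mapping.lookup f v = Poly_Mapping.lookup (bd 1 ?g) v" if "v \<in> vertices ?I X1 0" for v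
        using that bd[of ?g] r by simp
    qed
    ultimately show "f \<in> bd 1 ` chain_module ?I X1 1" by blast
  next
    fix f :: "idx vertex \<Rightarrow>\<^sub>0 'k qring"
    assume "f \<in> bd 1 ` chain_module ?I X1 1"
    then show "f \<in> {f \<in> chain_module ?I X1 0. augmentation f = 0}"
      using bd_in_chain_module[of 1] bd zero by auto
  qed
qed

lemma free_resolution_complex:
  "free_resolution free_scale
     (chain_module (I_rel :: (idx, 'k::field) mpoly set) X1 :: nat \<Rightarrow> (idx vertex \<Rightarrow>\<^sub>0 'k qring) set)
     bd cyc_scale augmentation"
proof -
  let ?P = "chain_module (I_rel :: (idx, 'k) mpoly set) X1 :: nat \<Rightarrow> (idx vertex \<Rightarrow>\<^sub>0 'k qring) set"
  have aug_linear: "linear_on free_scale cyc_scale (?P 0) augmentation"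
    unfolding linear_on_def augmentation_def
    by (simp add: lookup_add lookup_free_scale cyc_scale_abs_cyc plus_cyc.abs_eq)
  have aug_surj: "augmentation ` ?P 0 = UNIV"
  proof (rule UNIV_eq_I[symmetric])
    fix m :: "'k cyc"
    obtain r where "m = abs_cyc r" by (metis Quotient_abs_rep[OF Quotient_cyc])
    then show "m \<in> augmentation ` ?P 0"
      by (intro image_eqI[of _ _ "Poly_Mapping.single Deg0 r"])
        (simp_all add: augmentation_def chain_module_def free_module_on_def)
  qed
  have exact: "{p \<in> ?P n. bd n p = 0} = bd (n + 1) ` ?P (n + 1)" if "n \<ge> 1" for n
  proof -
    obtain m where "n = Suc m" using \<open>n \<ge> 1\<close> by (cases n) auto
    then show ?thesis using kernel_eq_image[of m] by simp
  qed
  have closed: "bd n ` ?P n \<subseteq> ?P (n - 1)" for n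
    by (rule image_subsetI) (rule bd_in_chain_module)
  have free: "free_submodule free_scale (?P n)" for n
    unfolding chain_module_def by (rule free_submodule_free_module_on)
  show ?thesis
    unfolding free_resolution_def
    by (intro conjI allI impI module_free_scale module_cyc_scale kernel_augmentation
        linear_bd aug_linear aug_surj closed free exact)
qed

section \<open>The matrices\<close>

text \<open>
  The pieces up to isomorphism, each encoded by its number of sources: 1 for an edge, 2 for a fork
  and 3 for a zigzag.
\<close>

primrec block_sizes :: "nat \<Rightarrow> nat list" where
  "block_sizes 0 = [1]"
| "block_sizes (Suc n) =
     concat (map (\<lambda>k. if k = 1 then [2] else if k = 2 then [3] else [2, 1, 2]) (block_sizes n))"

lemma block_sizes_pieces: "map (\<lambda>p. length (sources p)) (pieces I n) = block_sizes n"
proof (induction n)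
  case (Suc n)
  have "map (\<lambda>p. length (sources p)) (next_pieces \<mu> p) =
      (\<lambda>k. if k = 1 then [2] else if k = 2 then [3] else [2, 1, 2]) (length (sources p))" for \<mu> p
    by (cases p) auto
  then show ?case by (simp add: map_concat comp_def flip: Suc)
qed simp

text \<open>
  Passing to the next degree is a substitution and respects concatenation, so the identity
  propagates from its first instance.
\<close>

lemma block_sizes_rec: "block_sizes (n + 3) = block_sizes (n + 1) @ block_sizes n @ block_sizes (n + 1)"
proof (induction n)
  case 0
  show ?case by (simp add: numeral_3_eq_3)
next
  case (Suc n)
  have "block_sizes (Suc n + 3) =
      concat (map (\<lambda>k. if k = 1 then [2] else if k = 2 then [3] else [2, 1, 2]) (block_sizes (n + 3)))"
    by (simp only: add_Suc block_sizes.simps)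
  also have "\<dots> = block_sizes (Suc n + 1) @ block_sizes (Suc n) @ block_sizes (Suc n + 1)"
    unfolding Suc by simp
  finally show ?case .
qed

lemma sum_list_block_sizes: "sum_list (block_sizes n) = fib (n + 2)"
proof (induction n rule: less_induct)
  case (less n)
  consider "n = 0" | "n = 1" | "n = 2" | m where "n = m + 3"
    using le_Suc_ex[of 3 n] by (cases "n < 3") (auto simp: add.commute numeral_eq_Suc less_Suc_eq)
  then show ?case
  proof cases
    case (4 m)
    have "sum_list (block_sizes (m + 3)) = fib (m + 3) + (fib (m + 2) + fib (m + 3))"
      unfolding block_sizes_rec sum_list_append using less[of m] less[of "m + 1"] 4
      by (simp add: eval_nat_numeral del: block_sizes.simps fib.simps)
    also have "\<dots> = fib (m + 3 + 2)"
      by (simp add: numeral_eq_Suc)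
    finally show ?thesis using 4 by simp
  qed (simp_all add: numeral_eq_Suc)
qed

lemma length_basis: "length (basis I n) = fib (n + 1)"
proof (cases n)
  case 0
  then show ?thesis by (simp add: basis_def)
next
  case (Suc m)
  have "length (basis I (Suc m)) = sum_list (block_sizes m)"
    unfolding basis_Suc by (simp add: length_concat comp_def flip: block_sizes_pieces[of I])
  then show ?thesis using Suc by (simp add: sum_list_block_sizes)
qed

lemma mat_eq_diag_block_mat:
  fixes coef :: "'v \<Rightarrow> 'v \<Rightarrow> 'r::zero"
  assumes "distinct (concat (map S ps))" "distinct (concat (map T ps))"
    and "\<And>x y. x \<in> set (concat (map S ps)) \<Longrightarrow> y \<in> set (concat (map T ps)) \<Longrightarrow> coef x y \<noteq> 0 \<Longrightarrow>
      \<exists>p\<in>set ps. x \<in> set (S p) \<and> y \<in> set (T p)"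
  shows "mat (length (concat (map T ps))) (length (concat (map S ps)))
      (\<lambda>(r, c). coef (concat (map S ps) ! c) (concat (map T ps) ! r)) =
    diag_block_mat (map (\<lambda>p. mat (length (T p)) (length (S p)) (\<lambda>(r, c). coef (S p ! c) (T p ! r))) ps)"
  using assms
proof (induction ps)
  case Nil
  show ?case by (rule eq_matI) simp_all
next
  case (Cons p ps)
  let ?S = "concat (map S ps)" and ?T = "concat (map T ps)"
  have tail: "\<exists>q\<in>set ps. x \<in> set (S q) \<and> y \<in> set (T q)"
    if "x \<in> set ?S" "y \<in> set ?T" "coef x y \<noteq> 0" for x y
    using Cons.prems(3)[of x y] Cons.prems(1) that by auto
  have off: "coef x y = 0"
    if "x \<in> set (S p) \<and> y \<in> set ?T \<or> x \<in> set ?S \<and> y \<in> set (T p)" for x y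
    using Cons.prems(3)[of x y] Cons.prems(1,2) that by auto
  let ?m = "\<lambda>T S. mat (length T) (length S) (\<lambda>(r, c). coef (S ! c) (T ! r))"
  have IH: "diag_block_mat (map (\<lambda>p. ?m (T p) (S p)) ps) = ?m ?T ?S"
    using Cons.IH Cons.prems tail by simp
  have "?m (T p @ ?T) (S p @ ?S) =
      four_block_mat (?m (T p) (S p)) (0\<^sub>m (length (T p)) (length ?S)) (0\<^sub>m (length ?T) (length (S p))) (?m ?T ?S)"
  proof (rule eq_matI)
    fix r c
    assume "r < dim_row (four_block_mat (?m (T p) (S p)) (0\<^sub>m (length (T p)) (length ?S)) (0\<^sub>m (length ?T) (length (S p))) (?m ?T ?S))"
      "c < dim_col (four_block_mat (?m (T p) (S p)) (0\<^sub>m (length (T p)) (length ?S)) (0\<^sub>m (length ?T) (length (S p))) (?m ?T ?S))"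
    then have rc: "r < length (T p) + length ?T" "c < length (S p) + length ?S" by simp_all
    have offS: "coef (S p ! c) (?T ! (r - length (T p))) = 0" if "c < length (S p)" "\<not> r < length (T p)"
      using that rc by (intro off disjI1 conjI nth_mem) auto
    have offT: "coef (?S ! (c - length (S p))) (T p ! r) = 0" if "\<not> c < length (S p)" "r < length (T p)"
      using that rc by (intro off disjI2 conjI nth_mem) auto
    show "?m (T p @ ?T) (S p @ ?S) $$ (r, c) =
      four_block_mat (?m (T p) (S p)) (0\<^sub>m (length (T p)) (length ?S)) (0\<^sub>m (length ?T) (length (S p))) (?m ?T ?S) $$ (r, c)"
      using rc offS offT by (simp add: nth_append)
  qed simp_all
  then show ?case by (simp add: IH)
qed

definition block_mat :: "nat \<Rightarrow> 'k::field qring mat" where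
  "block_mat k = mat_of_rows_list k
     (if k = 1 then [[xvar X1]] else if k = 2 then [[xvar X2, xvar X3]]
      else [[xvar X1, xvar X3, 0], [0, - xvar X2, xvar X1]])"

lemma block_mat_piece:
  fixes f :: "idx vertex \<Rightarrow>\<^sub>0 'k::field qring"
  assumes p: "p \<in> set (pieces (I_rel :: (idx, 'k) mpoly set) n)"
  shows "mat (length (targets p)) (length (sources p))
      (\<lambda>(r, c). Poly_Mapping.lookup (bd (Suc n) (Poly_Mapping.single (sources p ! c) (1 :: 'k qring))) (targets p ! r))
    = block_mat (length (sources p))"
proof -
  have d: "distinct (sources p)" using separated_distinct[OF arrows_pieces(2) p] by simp
  have entry: "Poly_Mapping.lookup (bd (Suc n) h) (targets p ! r) = piece_map p (Poly_Mapping.lookup h) ! r"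
    if "r < length (targets p)" for r and h :: "idx vertex \<Rightarrow>\<^sub>0 'k qring"
    using arg_cong[OF bd_piece[OF p, of h], of "\<lambda>l. l ! r"] that by simp
  have single: "Poly_Mapping.lookup (Poly_Mapping.single v (1 :: 'k qring)) = (\<lambda>w. if w = v then 1 else 0)"
    for v :: "idx vertex"
    by (auto simp: lookup_single when_def)
  have "mat (length (targets p)) (length (sources p))
      (\<lambda>(r, c). Poly_Mapping.lookup (bd (Suc n) (Poly_Mapping.single (sources p ! c) (1 :: 'k qring))) (targets p ! r))
    = mat (length (targets p)) (length (sources p))
      (\<lambda>(r, c). piece_map p (\<lambda>v. if v = sources p ! c then 1 else 0) ! r)" 
    by (rule cong_mat) (simp_all add: entry single)
  also have "\<dots> = block_mat (length (sources p))"
    using d by (cases p; intro eq_matI) (auto simp: block_mat_def mat_of_rows_list_def less_Suc_eq numeral_eq_Suc)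
  finally show ?thesis .
qed

lemma differential_matrix_eq:
  "differential_matrix (I_rel :: (idx, 'k::field) mpoly set) X1 (xvar :: idx \<Rightarrow> 'k qring)
     (\<lambda>n. nth (basis (I_rel :: (idx, 'k) mpoly set) n)) (Suc n)
   = diag_block_mat (map block_mat (block_sizes n))"
proof -
  let ?I = "I_rel :: (idx, 'k) mpoly set"
  let ?coef = "\<lambda>x. Poly_Mapping.lookup (bd (Suc n) (Poly_Mapping.single x (1 :: 'k qring)))"
  have card: "card (vertices ?I X1 m) = length (basis ?I m)" for m
    unfolding vertices_basis by (rule distinct_card[OF distinct_basis])
  \<comment> \<open>A column index outside the piece of the row index contributes nothing to that row.\<close>
  have nz: "\<exists>p\<in>set (pieces ?I n). x \<in> set (sources p) \<and> y \<in> set (targets p)"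
    if "y \<in> set (concat (map targets (pieces ?I n)))" "?coef x y \<noteq> 0" for x y
  proof -
    obtain p where p: "p \<in> set (pieces ?I n)" "y \<in> set (targets p)"
      using \<open>y \<in> set (concat (map targets (pieces ?I n)))\<close> by auto
    have "x \<in> set (sources p)"
    proof (rule ccontr)
      assume "x \<notin> set (sources p)"
      then have "piece_map p (Poly_Mapping.lookup (Poly_Mapping.single x (1 :: 'k qring))) = piece_map p (\<lambda>_. 0)"
        by (intro piece_map_cong) (auto simp: lookup_single when_def)
      then have "set (map (?coef x) (targets p)) \<subseteq> {0}"
        unfolding bd_piece[OF p(1)] by (cases p) simp_all
      with p(2) that(2) show False by auto
    qed
    with p show ?thesis by blast
  qed
  have "differential_matrix ?I X1 (xvar :: idx \<Rightarrow> 'k qring) (\<lambda>n. nth (basis ?I n)) (Suc n)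
      = mat (length (concat (map targets (pieces ?I n)))) (length (concat (map sources (pieces ?I n))))
         (\<lambda>(r, c). ?coef (concat (map sources (pieces ?I n)) ! c) (concat (map targets (pieces ?I n)) ! r))"
    unfolding differential_matrix_def card by (simp add: basis_Suc) (simp add: basis_def)
  also have "\<dots> = diag_block_mat (map (\<lambda>p. mat (length (targets p)) (length (sources p))
      (\<lambda>(r, c). ?coef (sources p ! c) (targets p ! r))) (pieces ?I n))"
    using arrows_pieces(2)[where 'k='k, of n] nz
    by (intro mat_eq_diag_block_mat) (auto simp: separated_def)
  also have "map (\<lambda>p. mat (length (targets p)) (length (sources p))
      (\<lambda>(r, c). ?coef (sources p ! c) (targets p ! r))) (pieces ?I n) = map block_mat (block_sizes n)"
    unfolding block_sizes_pieces[of ?I, symmetric] map_map comp_def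
    by (intro map_cong refl block_mat_piece)
  finally show ?thesis .
qed

lemma diag_block_mat_append3:
  "diag_block_mat (As @ Bs @ Cs) = diag_block_mat [diag_block_mat As, diag_block_mat Bs, diag_block_mat Cs]"
  using diag_block_mat_singleton[of "diag_block_mat Cs"]
  unfolding diag_block_mat_append by (simp add: Let_def del: diag_block_mat_singleton)

theorem theorem11:
  shows "(\<exists>ord :: nat \<Rightarrow> nat \<Rightarrow> idx vertex.
      (\<forall>n. bij_betw (ord n) {..<fib (n + 1)} (vertices (I_rel :: (idx, 'k::field) mpoly set) X1 n)) \<and>
      (let D = differential_matrix (I_rel :: (idx, 'k) mpoly set) X1 (xvar :: idx \<Rightarrow> 'k qring) ord in
        D 1 = mat_of_rows_list 1 [[xvar X1]] \<and>
        D 2 = mat_of_rows_list 2 [[xvar X2, xvar X3]] \<and>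
        D 3 = mat_of_rows_list 3 [[xvar X1, xvar X3, 0], [0, - xvar X2, xvar X1]] \<and>
        (\<forall>n\<ge>4. D n = diag_block_mat [D (n - 2), D (n - 3), D (n - 2)])))
    \<and> free_resolution free_scale
        (chain_module (I_rel :: (idx, 'k) mpoly set) X1 :: nat \<Rightarrow> (idx vertex \<Rightarrow>\<^sub>0 'k qring) set)
        (differential (I_rel :: (idx, 'k) mpoly set) X1 xvar)
        cyc_scale augmentation"
proof (intro conjI exI[of _ "\<lambda>n. nth (basis (I_rel :: (idx, 'k) mpoly set) n)"] allI)
  let ?I = "I_rel :: (idx, 'k) mpoly set"
  fix n
  show "bij_betw (nth (basis ?I n)) {..<fib (n + 1)} (vertices ?I X1 n)"
    unfolding vertices_basis by (rule bij_betw_nth) (simp_all add: distinct_basis length_basis)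
next
  let ?I = "I_rel :: (idx, 'k) mpoly set"
  let ?D = "differential_matrix ?I X1 (xvar :: idx \<Rightarrow> 'k qring) (\<lambda>n. nth (basis ?I n))"
  have D: "?D (Suc n) = diag_block_mat (map block_mat (block_sizes n))" for n
    by (rule differential_matrix_eq)
  have "?D n = diag_block_mat [?D (n - 2), ?D (n - 3), ?D (n - 2)]" if "n \<ge> 4" for n
  proof -
    define m where "m = n - 4"
    have n: "n = Suc (m + 3)" "n - 2 = Suc (m + 1)" "n - 3 = Suc m"
      using that by (simp_all add: m_def)
    have "?D n = diag_block_mat (map block_mat (block_sizes (m + 3)))"
      unfolding n(1) by (rule D)
    also have "\<dots> = diag_block_mat [?D (Suc (m + 1)), ?D (Suc m), ?D (Suc (m + 1))]"
      unfolding D block_sizes_rec map_append diag_block_mat_append3 ..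
    finally show ?thesis unfolding n(2,3) .
  qed
  moreover have "?D 1 = mat_of_rows_list 1 [[xvar X1]]"
    using D[of 0] by (simp add: block_mat_def del: diag_block_mat.simps)
  moreover have "?D 2 = mat_of_rows_list 2 [[xvar X2, xvar X3]]"
    using D[of 1] by (simp add: block_mat_def numeral_2_eq_2 del: diag_block_mat.simps)
  moreover have "?D 3 = mat_of_rows_list 3 [[xvar X1, xvar X3, 0], [0, - xvar X2, xvar X1]]"
    using D[of 2] by (simp add: block_mat_def numeral_eq_Suc del: diag_block_mat.simps)
  ultimately show "let D = ?D in D 1 = mat_of_rows_list 1 [[xvar X1]] \<and>
        D 2 = mat_of_rows_list 2 [[xvar X2, xvar X3]] \<and>
        D 3 = mat_of_rows_list 3 [[xvar X1, xvar X3, 0], [0, - xvar X2, xvar X1]] \<and>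
        (\<forall>n\<ge>4. D n = diag_block_mat [D (n - 2), D (n - 3), D (n - 2)])"
    unfolding Let_def by blast
qed (rule free_resolution_complex)

end
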